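(* Let $x_1,\dots,x_d\in S^n$ be data points, where $S^n$ is identified with the unit sphere in $\mathbb{R}^{n+1}$, and let $X$ be the matrix whose columns are $x_1,\dots,x_d$. Distances are measured by the projection distance, and subspheres are restricted to positive dimension. Then the principal symmetric space approximation of $X$ with respect to $S^n$ is the unbranched tree $S^n\supset S^{n-1}\supset\dots\supset S^1$, where, for each $m$ with $0<m<n$, $S^{n-m}$ is the best approximating $(n-m)$-sphere in the projection distance, given by $S^{n-m}=S_N:=S^n\cap N$ with $N\subset\mathbb{R}^{n+1}$ the orthogonal complement of the span of the singular vectors corresponding to the smallest $m$ singular values of $X^{\mathsf T}$.
   Context: The singular vectors of $X^{\mathsf T}$ meant here are the orthonormal eigenvectors of $XX^{\mathsf T}$ in $\mathbb{R}^{n+1}$, the associated eigenvalues being the squares of the singular values. For a linear subspace $N\subset\mathbb{R}^{n+1}$, $S_N:=S^n\cap N$; the connected totally geodesic submanifolds of $S^n$ of positive dimension are the subspheres of this form. The projection distance $d_p(x,v)$ between $x,v\in S^n$ is the shortest Euclidean distance from $x$ to $\mathrm{span}(v)$ in $\mathbb{R}^{n+1}$; $d_p(x,S_N)=\min_{v\in S_N}d_p(x,v)$, and $d_p(X,S_N)^2=\sum_{j=1}^d d_p(x_j,S_N)^2$. For a Riemannian symmetric space $M=G/H$ with a distance $d$, data $X=(x_1,\dots,x_d)$ and $\mathcal{TG}(M)$ the set of connected totally geodesic submanifolds of $M$, put $d(X,N)^2=\sum_i d(x_i,N)^2$ with $d(x,N)=\min_{y\in N}d(x,y)$. The symmetric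 space approximations of $X$ with respect to $M$ are the elements of $\{gN\colon g=\mathrm{argmin}_{g\in G}\,d(X,gN),\ N\in\mathcal{TG}(M)\}$, where local minima are taken. The principal symmetric space approximation of $X$ with respect to $M$ is the rooted tree in which each node is a totally geodesic submanifold of $M$, the root node is $M$, and the children of a node $N$ are the symmetric space approximations of $X$ with respect to $N$.
   Formalization: Children of a node are its maximal proper approximations (taking all, each node is its own child). The unbranched tree and unique best spheres need the m-th and (m+1)-th smallest singular values to differ for 0<m<n; with ties the tree is the union of chains over all choices of singular vectors. *)

theory Defs
  imports "HOL-Analysis.Analysis" "HOL-Library.Sublist"
begin

text \<open>
  The sphere \<open>S^n\<close> is \<open>sphere 0 1 :: (real^'n) set\<close> with \<open>CARD('n) = n + 1\<close>, and the data points
  are the columns of \<open>X :: real^'d^'n\<close>.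
\<close>

definition great_sphere :: "(real^'n) set \<Rightarrow> (real^'n) set" where
  "great_sphere N = sphere 0 1 \<inter> N"

definition subsphere :: "nat \<Rightarrow> (real^'n) set \<Rightarrow> bool" where
  "subsphere k S \<longleftrightarrow> (\<exists>N. subspace N \<and> dim N = k + 1 \<and> S = great_sphere N)"

text \<open>
  The connected totally geodesic submanifolds of positive dimension of a great sphere \<open>M\<close>.
  The sphere \<open>M\<close> itself is one of them.
\<close>

definition tot_geodesic :: "(real^'n) set \<Rightarrow> (real^'n) set set" where
  "tot_geodesic M = {S. S \<subseteq> M \<and> (\<exists>k\<ge>1. subsphere k S)}"

text \<open>
  A great sphere with span \<open>V\<close> is the symmetric space \<open>SO(V) / SO(W)\<close>, with \<open>W\<close> a hyperplane
  of \<open>V\<close>. The group \<open>SO(V)\<close> is realised as the rotations of the ambient space that fix the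
  orthogonal complement of \<open>V\<close> pointwise.
\<close>

definition rotations :: "(real^'n) set \<Rightarrow> (real^'n^'n) set" where
  "rotations M = {g. rotation_matrix g \<and> (\<forall>w\<in>orthogonal_comp (span M). g *v w = w)}"

definition proj_dist :: "real^'n \<Rightarrow> real^'n \<Rightarrow> real" where
  "proj_dist x v = infdist x (span {v})"

text \<open>The infimum below is a minimum, as great spheres are compact.\<close>

definition proj_dist_set :: "real^'n \<Rightarrow> (real^'n) set \<Rightarrow> real" where
  "proj_dist_set x S = (INF v\<in>S. proj_dist x v)"

text \<open>\<open>L2_set f A\<close> is the square root of the sum of the squares of \<open>f\<close> over \<open>A\<close>.\<close>

definition data_dist :: "real^'d^'n \<Rightarrow> (real^'n) set \<Rightarrow> real" where
  "data_dist X S = L2_set (\<lambda>j. proj_dist_set (column j X) S) UNIV"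

definition local_argmin_on :: "'a::topological_space set \<Rightarrow> ('a \<Rightarrow> real) \<Rightarrow> 'a \<Rightarrow> bool" where
  "local_argmin_on G F g \<longleftrightarrow> g \<in> G \<and> (\<forall>\<^sub>F h in at g within G. F g \<le> F h)"

definition symm_space_approx :: "real^'d^'n \<Rightarrow> (real^'n) set \<Rightarrow> (real^'n) set set" where
  "symm_space_approx X M =
     {(\<lambda>x. g *v x) ` N | g N. N \<in> tot_geodesic M \<and>
        local_argmin_on (rotations M) (\<lambda>h. data_dist X ((\<lambda>x. h *v x) ` N)) g}"

text \<open>
  \<open>symm_space_approx X M\<close> contains \<open>M\<close> itself, and approximations of all lower dimensions, which
  may be contained in one another. The tree is ordered by inclusion: the children of \<open>M\<close> are
  the proper approximations with no further approximation strictly between them and \<open>M\<close>;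
  the smaller ones occur further down in the tree.
\<close>

definition psa_children :: "real^'d^'n \<Rightarrow> (real^'n) set \<Rightarrow> (real^'n) set set" where
  "psa_children X M =
     {C \<in> symm_space_approx X M. C \<noteq> M \<and> \<not> (\<exists>D\<in>symm_space_approx X M. C \<subset> D \<and> D \<subset> M)}"

text \<open>
  The principal symmetric space approximation. A rooted tree is represented by the set of the
  label sequences along its paths from the root, one path for each node of the tree.
\<close>

inductive_set psa :: "real^'d^'n \<Rightarrow> (real^'n) set \<Rightarrow> (real^'n) set list set"
  for X :: "real^'d^'n" and M :: "(real^'n) set" where
  root: "[M] \<in> psa X M"
| child: "p \<in> psa X M \<Longrightarrow> C \<in> psa_children X (last p) \<Longrightarrow> p @ [C] \<in> psa X M"

definition unbranched_tree :: "'a list \<Rightarrow> 'a list set" where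
  "unbranched_tree L = {p. p \<noteq> [] \<and> prefix p L}"

text \<open>
  All singular values \<open>s 0 \<le> s 1 \<le> \<dots>\<close> of \<open>transpose X\<close>, with associated singular vectors
  forming an orthonormal basis of the ambient space. Values at indices from \<open>CARD('n)\<close> on are
  irrelevant.
\<close>

definition singular_system :: "real^'d^'n \<Rightarrow> (nat \<Rightarrow> real) \<Rightarrow> (nat \<Rightarrow> real^'n) \<Rightarrow> bool" where
  "singular_system X s v \<longleftrightarrow>
     (\<forall>i<CARD('n). \<forall>j<CARD('n). v i \<bullet> v j = (if i = j then 1 else 0)) \<and>
     (\<forall>i<CARD('n). 0 \<le> s i \<and> (X ** transpose X) *v v i = (s i)\<^sup>2 *\<^sub>R v i) \<and>
     (\<forall>j<CARD('n). \<forall>i\<le>j. s i \<le> s j)"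

definition principal_sphere :: "(nat \<Rightarrow> real^'n) \<Rightarrow> nat \<Rightarrow> (real^'n) set" where
  "principal_sphere v m = great_sphere (orthogonal_comp (span (v ` {..<m})))"

end

theory Submission
  imports Defs
begin

text \<open>
  Put \<open>A = X X\<^sup>T\<close> and \<open>q(x) = x \<bullet> A x\<close>. By Pythagoras, the squared distance from the data to the
  great sphere of a subspace \<open>N\<close> is a constant minus the trace of \<open>A\<close> compressed to \<open>N\<close>
  (\<open>data_dist_great_sphere\<close>). So a good approximation is a subspace on which \<open>A\<close> has large trace,
  and everything takes place in linear algebra.

  The right notion is that \<open>N\<close> is dominant in \<open>V\<close>: some \<open>\<mu>\<close> is a lower bound for \<open>q\<close> on the unit
  sphere of \<open>N\<close> and an upper bound on that of the orthogonal complement of \<open>N\<close> in \<open>V\<close>, and these two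
  subspaces are orthogonal for the form of \<open>A\<close> as well. A dominant subspace minimises the distance
  among all subspaces of \<open>V\<close> of its dimension, by an inequality of Ky Fan (\<open>ky_fan\<close>).
  Conversely a local minimiser under rotations is already dominant (\<open>dominant_of_local_argmin\<close>):
  turning one unit vector \<open>u\<close> of \<open>N\<close> by the angle \<open>t\<close> towards a unit vector \<open>w\<close> of the complement
  changes the trace by
  \<open>2 sin t cos t (u \<bullet> A w) + (sin t)\<^sup>2 (q(w) - q(u))\<close>, and for this to be nonpositive for all small
  \<open>t\<close> of either sign one needs \<open>u \<bullet> A w = 0\<close> and \<open>q(w) \<le> q(u)\<close>. There are therefore no spurious local
  minima, and the symmetric space approximations with respect to the great sphere of \<open>V\<close> are exactly
  the great spheres of the dominant subspaces of dimension at least two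
  (\<open>symm_space_approx_great_sphere\<close>).

  Every proper dominant subspace of \<open>V\<close> lies in a dominant hyperplane of \<open>V\<close>, namely the complement
  of a unit vector minimising \<open>q\<close> on \<open>V\<close>. So passing to a child in the tree means splitting off such
  a minimiser, and a path from the root records a frame \<open>v 0, v 1, \<dots>\<close> in which each vector minimises
  \<open>q\<close> among the unit vectors orthogonal to the previous ones (\<open>greedy_frame\<close>, \<open>psa_iff\<close>). These
  frames are the systems of singular vectors in ascending order of singular value
  (\<open>singular_system_iff_greedy_frame\<close>). When singular values coincide there are several of them and
  the tree is the union of their chains. A gap between consecutive singular values makes Ky Fan's
  inequality strict, so that the minimiser of that dimension is unique
  (\<open>trace_maximiser_unique\<close>), and gaps everywhere leave a single chain.
\<close>

section \<open>Orthonormal sets and traces of symmetric operators on subspaces\<close>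

definition orthonormal :: "'a::real_inner set \<Rightarrow> bool" where
  "orthonormal B \<longleftrightarrow> pairwise orthogonal B \<and> (\<forall>b\<in>B. norm b = 1)"

lemma orthonormal_inner:
  assumes "orthonormal B" "a \<in> B" "b \<in> B"
  shows "a \<bullet> b = (if a = b then 1 else 0)"
  using assms by (auto simp: orthonormal_def pairwise_def orthogonal_def norm_eq_1)

lemma orthonormal_independent: "orthonormal (B::'a::euclidean_space set) \<Longrightarrow> independent B"
  by (rule pairwise_orthogonal_independent) (auto simp: orthonormal_def)

lemma orthonormal_finite: "orthonormal (B::'a::euclidean_space set) \<Longrightarrow> finite B"
  using orthonormal_independent independent_imp_finite by blast

lemma orthonormal_card_eq_dim:
  "orthonormal (B::'a::euclidean_space set) \<Longrightarrow> span B = N \<Longrightarrow> card B = dim N"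
  using orthonormal_independent indep_card_eq_dim_span dim_span by metis

lemma orthonormal_expand:
  fixes B :: "'a::euclidean_space set"
  assumes "orthonormal B" "x \<in> span B"
  shows "(\<Sum>b\<in>B. (x \<bullet> b) *\<^sub>R b) = x"
  using assms orthonormal_finite[OF assms(1)]
  by (intro orthonormal_basis_expand) (auto simp: orthonormal_def)

lemma orthonormal_basis_exists:
  fixes N :: "'a::euclidean_space set"
  assumes "subspace N"
  obtains B where "orthonormal B" "span B = N"
  using orthonormal_basis_subspace[OF assms] unfolding orthonormal_def by metis

lemma nonzero_of_dim_pos: "0 < dim N \<Longrightarrow> N \<noteq> {0::'a::euclidean_space}"
  by auto

lemma mem_orthogonal_comp_span:
  "x \<in> orthogonal_comp (span B) \<longleftrightarrow> (\<forall>b\<in>B. x \<bullet> b = 0)"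
  unfolding orthogonal_comp_def orthogonal_def
  using orthogonal_to_span[of _ B x] span_base[of _ B]
  by (auto simp: orthogonal_def inner_commute)

lemma mem_orthogonal_comp:
  "x \<in> orthogonal_comp N \<longleftrightarrow> (\<forall>b\<in>N. x \<bullet> b = 0)"
  unfolding orthogonal_comp_def orthogonal_def by (auto simp: inner_commute)

text \<open>
  The rest term stays inside \<open>V\<close>, because all later comparisons take place relative to the span
  \<open>V\<close> of a great sphere rather than in the whole space.
\<close>

lemma orthogonal_decomposition:
  fixes N V :: "'a::euclidean_space set"
  assumes "subspace N" "subspace V" "N \<subseteq> V" "x \<in> V"
  obtains p r where "p \<in> N" "r \<in> V \<inter> orthogonal_comp N" "x = p + r"
proof -
  obtain p r where pr: "p \<in> span N" "\<And>w. w \<in> span N \<Longrightarrow> orthogonal r w" "x = p + r"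
    using orthogonal_subspace_decomp_exists by metis
  have "p \<in> N" using pr(1) assms(1) span_eq_iff by metis
  moreover have "r \<in> V" using \<open>p \<in> N\<close> assms pr(3) subspace_diff[of V x p] by auto
  moreover have "r \<in> orthogonal_comp N"
    using pr(2) span_base[of _ N] by (auto simp: mem_orthogonal_comp orthogonal_def)
  ultimately show thesis using that pr(3) by blast
qed

lemma dim_orthogonal_comp_within:
  fixes N V :: "'a::euclidean_space set"
  assumes "subspace N" "subspace V" "N \<subseteq> V"
  shows "dim (V \<inter> orthogonal_comp N) + dim N = dim V"
proof -
  have "{y \<in> V. \<forall>x\<in>N. orthogonal x y} = V \<inter> orthogonal_comp N"
    by (auto simp: orthogonal_comp_def)
  then show ?thesis using dim_subspace_orthogonal_to_vectors[OF assms] by simp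
qed

text \<open>
  The union of \<open>B\<close> with an orthonormal basis of the complement of its span in \<open>V\<close> does it.
\<close>

lemma orthonormal_extend:
  fixes B V :: "'a::euclidean_space set"
  assumes "orthonormal B" "B \<subseteq> V" "subspace V"
  obtains C where "orthonormal C" "B \<subseteq> C" "span C = V"
proof -
  have sub: "subspace (V \<inter> orthogonal_comp (span B))"
    using assms(3) subspace_orthogonal_comp subspace_inter by blast
  obtain D where D: "orthonormal D" "span D = V \<inter> orthogonal_comp (span B)"
    using orthonormal_basis_exists[OF sub] .
  have DB: "d \<bullet> b = 0" if "d \<in> D" "b \<in> B" for d b
    using that D(2) span_base[of d D] by (auto simp: mem_orthogonal_comp_span)
  have "orthonormal (B \<union> D)"
    using assms(1) D(1) DB
    unfolding orthonormal_def pairwise_def orthogonal_def by (metis UnE inner_commute)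
  moreover have "span (B \<union> D) = V"
  proof
    have "D \<subseteq> V" using D(2) span_superset[of D] by auto
    with assms show "span (B \<union> D) \<subseteq> V" by (simp add: span_minimal)
    show "V \<subseteq> span (B \<union> D)"
    proof
      fix x assume "x \<in> V"
      moreover have "span B \<subseteq> V" using assms by (simp add: span_minimal)
      ultimately obtain p r where "p \<in> span B" "r \<in> span D" "x = p + r"
        using orthogonal_decomposition[of "span B" V x] D(2) assms(3) subspace_span by metis
      then show "x \<in> span (B \<union> D)"
        by (metis span_add span_mono subsetD sup_ge1 sup_ge2)
    qed
  qed
  ultimately show thesis using that by blast
qed

text \<open>
  For orthogonal projection \<open>P\<close> onto \<open>N\<close> this is the trace of \<open>P f P\<close>. The choice of basis is
  immaterial by the next two lemmas.
\<close>

definition trace_on :: "('a::euclidean_space \<Rightarrow> 'a) \<Rightarrow> 'a set \<Rightarrow> real" where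
  "trace_on f N = (\<Sum>b\<in>(SOME B. orthonormal B \<and> span B = N). b \<bullet> f b)"

text \<open>
  Both sums equal the double sum of \<open>(b \<bullet> c) * (c \<bullet> f b)\<close>: expand the left factor \<open>b\<close> in the basis
  \<open>C\<close>, or the argument \<open>c\<close> of \<open>f\<close> in the basis \<open>B\<close>.
\<close>

lemma trace_basis_independent:
  fixes f :: "'a::euclidean_space \<Rightarrow> 'a"
  assumes f: "linear f" and B: "orthonormal B" and C: "orthonormal C" and eq: "span B = span C"
  shows "(\<Sum>b\<in>B. b \<bullet> f b) = (\<Sum>c\<in>C. c \<bullet> f c)"
proof -
  interpret f: linear f by fact
  have "(\<Sum>b\<in>B. b \<bullet> f b) = (\<Sum>b\<in>B. \<Sum>c\<in>C. (b \<bullet> c) * (c \<bullet> f b))"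
  proof (rule sum.cong[OF refl])
    fix b assume "b \<in> B"
    then have "b = (\<Sum>c\<in>C. (b \<bullet> c) *\<^sub>R c)"
      using orthonormal_expand[OF C, of b] eq span_base[of b B] by simp
    then have "b \<bullet> f b = (\<Sum>c\<in>C. (b \<bullet> c) *\<^sub>R c) \<bullet> f b" by simp
    then show "b \<bullet> f b = (\<Sum>c\<in>C. (b \<bullet> c) * (c \<bullet> f b))" by (simp add: inner_sum_left)
  qed
  also have "\<dots> = (\<Sum>c\<in>C. \<Sum>b\<in>B. (b \<bullet> c) * (c \<bullet> f b))" by (rule sum.swap)
  also have "\<dots> = (\<Sum>c\<in>C. c \<bullet> f c)"
  proof (rule sum.cong[OF refl])
    fix c assume "c \<in> C"
    then have c: "c = (\<Sum>b\<in>B. (c \<bullet> b) *\<^sub>R b)"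
      using orthonormal_expand[OF B, of c] eq span_base[of c C] by simp
    have "c \<bullet> f c = c \<bullet> f (\<Sum>b\<in>B. (c \<bullet> b) *\<^sub>R b)" using c by simp
    also have "\<dots> = (\<Sum>b\<in>B. (c \<bullet> b) * (c \<bullet> f b))"
      by (simp add: f.sum f.scale inner_sum_right)
    finally show "(\<Sum>b\<in>B. (b \<bullet> c) * (c \<bullet> f b)) = c \<bullet> f c" by (simp add: inner_commute)
  qed
  finally show ?thesis .
qed

lemma trace_on_eq:
  fixes f :: "'a::euclidean_space \<Rightarrow> 'a"
  assumes "linear f" "orthonormal B" "span B = N"
  shows "trace_on f N = (\<Sum>b\<in>B. b \<bullet> f b)"
proof -
  define C where "C = (SOME B. orthonormal B \<and> span B = N)"
  have "orthonormal C \<and> span C = N"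
    unfolding C_def by (rule someI[of _ B]) (use assms in auto)
  then show ?thesis
    using trace_basis_independent[OF assms(1), of C B] assms
    by (simp add: trace_on_def C_def[symmetric])
qed

section \<open>Extremal subspaces\<close>

locale symmetric_operator =
  fixes f :: "'a::euclidean_space \<Rightarrow> 'a"
  assumes linear: "linear f"
    and symmetric: "f x \<bullet> y = x \<bullet> f y"
begin

definition quad :: "'a \<Rightarrow> real" where
  "quad x = x \<bullet> f x"

text \<open>
  The subspace \<open>N\<close> collects a largest part of the spectrum of the compression of \<open>f\<close> to \<open>V\<close>. Since
  \<open>f\<close> need not preserve \<open>V\<close>, the last conjunct asks only that the compression preserves \<open>N\<close>.
\<close>

definition dominant :: "'a set \<Rightarrow> 'a set \<Rightarrow> bool" where
  "dominant N V \<longleftrightarrow> (\<exists>\<mu>. (\<forall>u\<in>N. \<mu> * (u \<bullet> u) \<le> quad u) \<and>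
     (\<forall>w\<in>V \<inter> orthogonal_comp N. quad w \<le> \<mu> * (w \<bullet> w) \<and> (\<forall>u\<in>N. u \<bullet> f w = 0)))"

lemma quad_combination:
  "quad (a *\<^sub>R x + b *\<^sub>R y) = a\<^sup>2 * quad x + b\<^sup>2 * quad y + 2 * a * b * (x \<bullet> f y)"
proof -
  interpret f: linear f by (rule linear)
  have "y \<bullet> f x = x \<bullet> f y" by (metis symmetric inner_commute)
  then show ?thesis
    unfolding quad_def by (simp add: f.add f.scale algebra_simps power2_eq_square)
qed

lemma quad_add: "x \<bullet> f y = 0 \<Longrightarrow> quad (x + y) = quad x + quad y"
  using quad_combination[of 1 x 1 y] by simp

lemma quad_scale: "quad (a *\<^sub>R x) = a\<^sup>2 * quad x"
  using quad_combination[of a x 0 0] by simp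

lemma continuous_quad: "continuous_on S quad"
  unfolding quad_def
  using linear_continuous_on[OF linear_conv_bounded_linear[THEN iffD1, OF linear]]
  by (intro continuous_on_inner continuous_on_id)

text \<open>
  With \<open>P\<close> the projection onto the span of \<open>B\<close>, the left side is a part of the trace of the
  positive semidefinite operator \<open>P f P\<close>, computed in a basis of the whole space that extends \<open>C\<close>.
  The right side is that same trace, computed in a basis that extends \<open>B\<close>.
\<close>

lemma compressed_trace_le:
  assumes B: "orthonormal B" and C: "orthonormal C"
    and pos: "\<And>u. u \<in> span B \<Longrightarrow> 0 \<le> quad u"
  shows "(\<Sum>c\<in>C. quad (\<Sum>b\<in>B. (c \<bullet> b) *\<^sub>R b)) \<le> (\<Sum>b\<in>B. quad b)"
proof -
  interpret f: linear f by (rule linear)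
  define P where "P x = (\<Sum>b\<in>B. (x \<bullet> b) *\<^sub>R b)" for x
  have Psym: "P x \<bullet> y = x \<bullet> P y" for x y
    unfolding P_def by (simp add: inner_sum_left inner_sum_right inner_commute mult.commute)
  have "linear P"
    unfolding P_def
    by (intro linearI) (simp_all add: inner_add_left scaleR_add_left sum.distrib scaleR_sum_right)
  then have lin: "linear (\<lambda>x. P (f (P x)))"
    using linear_compose[OF linear_compose[OF \<open>linear P\<close> linear] \<open>linear P\<close>] by (simp add: o_def)
  have q: "quad (P x) = x \<bullet> P (f (P x))" for x
    unfolding quad_def by (simp add: Psym)
  have Pspan: "P x \<in> span B" for x
    unfolding P_def by (intro span_sum span_scale span_base)
  obtain C' where C': "orthonormal C'" "C \<subseteq> C'" "span C' = UNIV"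
    using orthonormal_extend[OF C subset_UNIV subspace_UNIV] .
  obtain B' where B': "orthonormal B'" "B \<subseteq> B'" "span B' = UNIV"
    using orthonormal_extend[OF B subset_UNIV subspace_UNIV] .
  have PB: "P b = b" if "b \<in> B" for b
    unfolding P_def using orthonormal_expand[OF B] that span_base by blast
  have P0: "P b = 0" if "b \<in> B' - B" for b
    unfolding P_def using orthonormal_inner[OF B'(1)] that B'(2)
    by (intro sum.neutral ballI) (auto split: if_splits)
  have "(\<Sum>c\<in>C. quad (P c)) \<le> (\<Sum>c\<in>C'. quad (P c))"
    using C' orthonormal_finite pos Pspan by (intro sum_mono2) auto
  also have "\<dots> = (\<Sum>b\<in>B'. quad (P b))"
    unfolding q using trace_basis_independent[OF lin C'(1) B'(1)] C'(3) B'(3) by simp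
  also have "\<dots> = (\<Sum>b\<in>B. quad (P b))"
    using B' orthonormal_finite P0 f.zero
    by (intro sum.mono_neutral_right) (auto simp: quad_def)
  also have "\<dots> = (\<Sum>b\<in>B. quad b)" by (simp add: PB)
  finally show ?thesis unfolding P_def .
qed

lemma symmetric_operator_shift: "symmetric_operator (\<lambda>x. f x - \<mu> *\<^sub>R x)"
proof -
  interpret f: linear f by (rule linear)
  show ?thesis
    by unfold_locales (simp_all add: f.add f.scale algebra_simps symmetric)
qed

text \<open>
  After subtracting \<open>\<mu>\<close> from \<open>f\<close>, which shifts both traces by the same amount since the dimensions
  agree, the form is nonnegative on \<open>N\<close> and nonpositive on its complement. Splitting the vectors of
  an orthonormal basis of \<open>D\<close> along \<open>N\<close> and dropping the nonpositive terms leaves a sum bounded by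
  the trace on \<open>N\<close>. If the form is negative on the complement away from \<open>0\<close>, equality allows no
  component of \<open>D\<close> outside \<open>N\<close>.
\<close>

lemma ky_fan:
  assumes V: "subspace V" and N: "subspace N" "N \<subseteq> V" and D: "subspace D" "D \<subseteq> V"
    and dim: "dim D = dim N"
    and ge: "\<And>u. u \<in> N \<Longrightarrow> \<mu> * (u \<bullet> u) \<le> quad u"
    and le: "\<And>w. w \<in> V \<inter> orthogonal_comp N \<Longrightarrow> quad w \<le> \<mu> * (w \<bullet> w)"
    and cross: "\<And>u w. u \<in> N \<Longrightarrow> w \<in> V \<inter> orthogonal_comp N \<Longrightarrow> u \<bullet> f w = 0"
  shows "trace_on f D \<le> trace_on f N"
    and "\<lbrakk>\<And>w. w \<in> V \<inter> orthogonal_comp N \<Longrightarrow> w \<noteq> 0 \<Longrightarrow> quad w < \<mu> * (w \<bullet> w);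
          trace_on f N \<le> trace_on f D\<rbrakk> \<Longrightarrow> D = N"
proof -
  interpret g: symmetric_operator "\<lambda>x. f x - \<mu> *\<^sub>R x" by (rule symmetric_operator_shift)
  have gq: "g.quad x = quad x - \<mu> * (x \<bullet> x)" for x
    unfolding g.quad_def quad_def by (simp add: inner_diff_right)
  obtain B where B: "orthonormal B" "span B = N" using orthonormal_basis_exists[OF N(1)] .
  obtain C where C: "orthonormal C" "span C = D" using orthonormal_basis_exists[OF D(1)] .
  define p where "p x = (\<Sum>b\<in>B. (x \<bullet> b) *\<^sub>R b)" for x
  have pN: "p x \<in> N" for x
    unfolding p_def B(2)[symmetric] by (intro span_sum span_scale span_base)
  have rest: "x - p x \<in> V \<inter> orthogonal_comp N" if "x \<in> D" for x
  proof -
    have "(x - p x) \<bullet> b = 0" if "b \<in> B" for b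
    proof -
      have "p x \<bullet> b = (\<Sum>c\<in>B. if c = b then x \<bullet> b else 0)"
        unfolding p_def inner_sum_left
        by (rule sum.cong) (use orthonormal_inner[OF B(1)] that in auto)
      then show ?thesis
        using orthonormal_finite[OF B(1)] that by (simp add: inner_diff_left)
    qed
    then have "x - p x \<in> orthogonal_comp N"
      unfolding B(2)[symmetric] mem_orthogonal_comp_span by blast
    moreover have "x - p x \<in> V" using that D pN N V subspace_diff by blast
    ultimately show ?thesis by blast
  qed
  have split: "g.quad x = g.quad (p x) + g.quad (x - p x)" if "x \<in> D" for x
  proof -
    have "p x \<bullet> (x - p x) = 0"
      using rest[OF that] pN[of x] by (auto simp: mem_orthogonal_comp inner_commute)
    then have "p x \<bullet> (f (x - p x) - \<mu> *\<^sub>R (x - p x)) = 0"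
      using cross[OF pN rest[OF that]] by (simp add: inner_diff_right[of _ "f _"])
    from g.quad_add[OF this] show ?thesis by simp
  qed
  have CD: "c \<in> D" if "c \<in> C" for c using that C(2) span_base by blast
  have tr: "(\<Sum>c\<in>S. g.quad c) = trace_on f M - \<mu> * dim N"
    if S: "orthonormal S" "span S = M" "dim M = dim N" for S M
  proof -
    have "(\<Sum>c\<in>S. g.quad c) = (\<Sum>c\<in>S. c \<bullet> f c - \<mu>)"
      by (rule sum.cong) (auto simp: gq quad_def orthonormal_inner[OF S(1)])
    then show ?thesis
      using trace_on_eq[OF linear S(1,2)] orthonormal_card_eq_dim[OF S(1,2)] S(3)
      by (simp add: sum_subtractf)
  qed
  have sumC: "(\<Sum>c\<in>C. g.quad c) = (\<Sum>c\<in>C. g.quad (p c)) + (\<Sum>c\<in>C. g.quad (c - p c))"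
    unfolding sum.distrib[symmetric] by (rule sum.cong) (use split CD in auto)
  have main: "(\<Sum>c\<in>C. g.quad (p c)) \<le> (\<Sum>b\<in>B. g.quad b)"
    unfolding p_def using ge B(2) by (intro g.compressed_trace_le B(1) C(1)) (auto simp: gq)
  have neg: "g.quad (c - p c) \<le> 0" if "c \<in> C" for c
    using le[OF rest[OF CD[OF that]]] by (simp add: gq)
  have key: "trace_on f D \<le> trace_on f N + (\<Sum>c\<in>C. g.quad (c - p c))"
    using sumC main tr[OF C dim] tr[OF B refl] by linarith
  then show "trace_on f D \<le> trace_on f N"
    using sum_nonpos[of C "\<lambda>c. g.quad (c - p c)", OF neg] by linarith
  show "D = N" if strict: "\<And>w. w \<in> V \<inter> orthogonal_comp N \<Longrightarrow> w \<noteq> 0 \<Longrightarrow> quad w < \<mu> * (w \<bullet> w)"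
    and tge: "trace_on f N \<le> trace_on f D"
  proof -
    have "C \<subseteq> N"
    proof
      fix c assume c: "c \<in> C"
      have "(\<Sum>c\<in>C. - g.quad (c - p c)) \<le> 0" using key tge by (simp add: sum_negf)
      then have "(\<Sum>c\<in>C. - g.quad (c - p c)) = 0"
        using neg by (intro antisym sum_nonneg) auto
      then have "g.quad (c - p c) = 0"
        using sum_nonneg_eq_0_iff[OF orthonormal_finite[OF C(1)], of "\<lambda>c. - g.quad (c - p c)"]
          neg c by auto
      then have "c - p c = 0"
        using strict[OF rest[OF CD[OF c]]] by (force simp: gq)
      then show "c \<in> N" using pN[of c] by simp
    qed
    then have "D \<subseteq> N" using C(2) N(1) span_minimal by blast
    then show ?thesis using subspace_dim_equal[OF D(1) N(1)] dim by simp
  qed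
qed

lemma dominant_trace_max:
  assumes "subspace V" "subspace N" "N \<subseteq> V" "subspace D" "D \<subseteq> V" "dim D = dim N"
    and "dominant N V"
  shows "trace_on f D \<le> trace_on f N"
proof -
  obtain \<mu> where \<mu>: "\<forall>u\<in>N. \<mu> * (u \<bullet> u) \<le> quad u"
    "\<forall>w\<in>V \<inter> orthogonal_comp N. quad w \<le> \<mu> * (w \<bullet> w) \<and> (\<forall>u\<in>N. u \<bullet> f w = 0)"
    using assms(7) unfolding dominant_def by blast
  show ?thesis
    by (rule ky_fan(1)[OF assms(1-6), of \<mu>]) (use \<mu> in auto)
qed

lemma quad_normalize: "x \<noteq> 0 \<Longrightarrow> quad (x /\<^sub>R norm x) = quad x / (x \<bullet> x)"
  unfolding quad_scale by (simp add: power_inverse power2_norm_eq_inner divide_inverse)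

lemma quad_min_exists:
  assumes V: "subspace V" and ne: "V \<noteq> {0}"
  obtains w where "w \<in> V" "norm w = 1" "\<And>x. x \<in> V \<Longrightarrow> quad w * (x \<bullet> x) \<le> quad x"
proof -
  obtain x where x: "x \<in> V" "x \<noteq> 0" using ne V subspace_0 by blast
  have "compact (V \<inter> sphere 0 1)"
    using closed_subspace[OF V] compact_sphere closed_Int_compact by blast
  moreover have "x /\<^sub>R norm x \<in> V \<inter> sphere 0 1"
    using x V by (simp add: subspace_scale)
  ultimately obtain w where w: "w \<in> V \<inter> sphere 0 1" "\<And>y. y \<in> V \<inter> sphere 0 1 \<Longrightarrow> quad w \<le> quad y"
    using continuous_attains_inf[OF _ _ continuous_quad, of "V \<inter> sphere 0 1"] by blast
  have "quad w * (y \<bullet> y) \<le> quad y" if "y \<in> V" for y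
  proof (cases "y = 0")
    case True
    then show ?thesis by (simp add: quad_def)
  next
    case False
    then have "y /\<^sub>R norm y \<in> V \<inter> sphere 0 1" using that V by (simp add: subspace_scale)
    then have "quad w \<le> quad (y /\<^sub>R norm y)" by (rule w(2))
    then show ?thesis using quad_normalize[OF False] False by (simp add: pos_le_divide_eq)
  qed
  with w(1) that show thesis by auto
qed

text \<open>
  The first order condition at a constrained minimum: otherwise the form would fall below its
  minimum at \<open>w + t x\<close> for some small \<open>t\<close>.
\<close>

lemma quad_min_orthogonal:
  assumes V: "subspace V" and w: "w \<in> V" "norm w = 1"
    and min: "\<And>x. x \<in> V \<Longrightarrow> quad w * (x \<bullet> x) \<le> quad x"
    and x: "x \<in> V" "x \<bullet> w = 0"
  shows "x \<bullet> f w = 0"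
proof (rule ccontr)
  assume ne: "x \<bullet> f w \<noteq> 0"
  define c where "c = quad x - quad w * (x \<bullet> x)"
  have *: "0 \<le> t\<^sup>2 * c + 2 * t * (x \<bullet> f w)" for t
  proof -
    have "t *\<^sub>R x + 1 *\<^sub>R w \<in> V" using V w(1) x(1) by (simp add: subspace_add subspace_scale)
    from min[OF this] show ?thesis
      unfolding quad_combination using w(2) x(2)
      by (simp add: c_def algebra_simps inner_commute power2_eq_square norm_eq_1)
  qed
  \<comment> \<open>close to the minimiser of the right side of \<open>*\<close>, with \<open>\<bar>c\<bar> + 1\<close> instead of \<open>c\<close> to keep the
    denominator positive\<close>
  define t where "t = - (x \<bullet> f w) / (\<bar>c\<bar> + 1)"
  have "t\<^sup>2 * c + 2 * t * (x \<bullet> f w) = (x \<bullet> f w)\<^sup>2 * (c - 2 * (\<bar>c\<bar> + 1)) / (\<bar>c\<bar> + 1)\<^sup>2"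
    unfolding t_def by (simp add: divide_simps power2_eq_square) (simp add: algebra_simps)
  also have "\<dots> < 0"
    using ne by (intro divide_neg_pos mult_pos_neg) auto
  finally show False using *[of t] by simp
qed

text \<open>
  The minimum of the form on the unit sphere of \<open>N\<close> is attained, and serves as the separating
  value \<open>\<mu>\<close>.
\<close>

lemma dominant_of_pairwise:
  assumes N: "subspace N" "N \<noteq> {0}" and V: "subspace V"
    and pair: "\<And>u w. \<lbrakk>u \<in> N; norm u = 1; w \<in> V \<inter> orthogonal_comp N; norm w = 1\<rbrakk>
        \<Longrightarrow> u \<bullet> f w = 0 \<and> quad w \<le> quad u"
  shows "dominant N V"
proof -
  obtain u0 where u0: "u0 \<in> N" "norm u0 = 1" "\<And>x. x \<in> N \<Longrightarrow> quad u0 * (x \<bullet> x) \<le> quad x"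
    using quad_min_exists[OF N] by blast
  interpret f: linear f by (rule linear)
  have "quad w \<le> quad u0 * (w \<bullet> w) \<and> (\<forall>u\<in>N. u \<bullet> f w = 0)"
    if w: "w \<in> V \<inter> orthogonal_comp N" for w
  proof (cases "w = 0")
    case True
    then show ?thesis by (simp add: quad_def f.zero)
  next
    case False
    have sub: "subspace (V \<inter> orthogonal_comp N)"
      using V subspace_orthogonal_comp subspace_inter by blast
    have w': "w /\<^sub>R norm w \<in> V \<inter> orthogonal_comp N" "norm (w /\<^sub>R norm w) = 1"
      using subspace_scale[OF sub w] False by auto
    have "quad w \<le> quad u0 * (w \<bullet> w)"
      using pair[OF u0(1,2) w'] False unfolding quad_normalize[OF False] by (simp add: pos_divide_le_eq)
    moreover have "u \<bullet> f w = 0" if "u \<in> N" for u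
    proof (cases "u = 0")
      case False': False
      have "u /\<^sub>R norm u \<in> N" "norm (u /\<^sub>R norm u) = 1"
        using that False' N(1) subspace_scale by auto
      from pair[OF this w'] show ?thesis using False False' by (simp add: f.scale)
    qed simp
    ultimately show ?thesis by blast
  qed
  with u0 show ?thesis unfolding dominant_def by blast
qed

text \<open>
  A minimiser on the complement of a dominant subspace is a minimiser on all of \<open>V\<close>, because
  the form is larger on \<open>N\<close> and has no cross terms.
\<close>

lemma dominant_hyperplane_min:
  assumes V: "subspace V" and N: "subspace N" "N \<subseteq> V" and dom: "dominant N V"
    and w: "w \<in> V \<inter> orthogonal_comp N" "norm w = 1"
    and min: "\<And>x. x \<in> V \<inter> orthogonal_comp N \<Longrightarrow> quad w * (x \<bullet> x) \<le> quad x"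
    and x: "x \<in> V"
  shows "quad w * (x \<bullet> x) \<le> quad x"
proof -
  obtain \<mu> where \<mu>: "\<And>u. u \<in> N \<Longrightarrow> \<mu> * (u \<bullet> u) \<le> quad u"
    "\<And>w. w \<in> V \<inter> orthogonal_comp N \<Longrightarrow> quad w \<le> \<mu> * (w \<bullet> w)"
    "\<And>u w. w \<in> V \<inter> orthogonal_comp N \<Longrightarrow> u \<in> N \<Longrightarrow> u \<bullet> f w = 0"
    using dom unfolding dominant_def by blast
  obtain p r where pr: "p \<in> N" "r \<in> V \<inter> orthogonal_comp N" "x = p + r"
    using orthogonal_decomposition[OF N(1) V N(2) x] .
  have pr0: "p \<bullet> r = 0" using pr by (auto simp: mem_orthogonal_comp inner_commute)
  have "quad w \<le> \<mu>" using \<mu>(2)[OF w(1)] w(2) by (simp add: norm_eq_1)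
  then have "quad w * (p \<bullet> p) \<le> quad p"
    using \<mu>(1)[OF pr(1)] mult_right_mono[of "quad w" \<mu> "p \<bullet> p"] by simp
  moreover have "quad x = quad p + quad r"
    unfolding pr(3) by (rule quad_add[OF \<mu>(3)[OF pr(2,1)]])
  ultimately show ?thesis
    using min[OF pr(2)] pr0 by (simp add: pr(3) algebra_simps inner_commute)
qed

text \<open>
  Together with the previous lemma this embeds every proper dominant subspace in a dominant
  hyperplane of \<open>V\<close>.
\<close>

lemma dominant_hyperplane:
  assumes V: "subspace V" and w: "w \<in> V" "norm w = 1"
    and min: "\<And>x. x \<in> V \<Longrightarrow> quad w * (x \<bullet> x) \<le> quad x"
  shows "dominant (V \<inter> orthogonal_comp (span {w})) V"
  unfolding dominant_def
proof (intro exI[of _ "quad w"] conjI ballI)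
  interpret f: linear f by (rule linear)
  let ?N = "V \<inter> orthogonal_comp (span {w})"
  show "quad w * (u \<bullet> u) \<le> quad u" if "u \<in> ?N" for u
    using min that by blast
  fix x assume x: "x \<in> V \<inter> orthogonal_comp ?N"
  have "span {w} \<subseteq> V" using w V by (simp add: span_minimal)
  then obtain p r where pr: "p \<in> span {w}" "r \<in> ?N" "x = p + r"
    using orthogonal_decomposition[OF subspace_span V, of "{w}" x] x by auto
  have "x \<bullet> r = 0" using x pr(2) by (simp add: mem_orthogonal_comp)
  moreover have "p \<bullet> r = 0" using pr(1,2) by (simp add: mem_orthogonal_comp inner_commute)
  ultimately have "r = 0" using pr(3) by (simp add: inner_add_left)
  then obtain c where c: "x = c *\<^sub>R w" using pr by (auto simp: span_singleton)
  show "quad x \<le> quad w * (x \<bullet> x)"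
    using w(2) by (simp add: c quad_scale norm_eq_1 power2_eq_square)
  fix u assume "u \<in> ?N"
  then have "u \<in> V" "u \<bullet> w = 0" by (auto simp: mem_orthogonal_comp_span)
  then show "u \<bullet> f x = 0"
    using quad_min_orthogonal[OF V w min] by (simp add: c f.scale)
qed

end

section \<open>Frames of successive minimisers of the quadratic form\<close>

definition tail_space :: "(nat \<Rightarrow> 'a::euclidean_space) \<Rightarrow> nat \<Rightarrow> 'a set" where
  "tail_space v m = orthogonal_comp (span (v ` {..<m}))"

lemma mem_tail_space: "x \<in> tail_space v m \<longleftrightarrow> (\<forall>j<m. x \<bullet> v j = 0)"
  by (auto simp: tail_space_def mem_orthogonal_comp_span)

lemma subspace_tail_space: "subspace (tail_space v m)"
  unfolding tail_space_def by (rule subspace_orthogonal_comp)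

lemma tail_space_mono: "i \<le> j \<Longrightarrow> tail_space v j \<subseteq> tail_space v i"
  by (auto simp: mem_tail_space)

lemma tail_space_cong: "(\<And>i. i < m \<Longrightarrow> v i = w i) \<Longrightarrow> tail_space v m = tail_space w m"
  by (auto simp: mem_tail_space)

context symmetric_operator begin

text \<open>
  By the variational characterisation of eigenvalues, these are the orthonormal systems of
  eigenvectors for the \<open>k\<close> smallest eigenvalues in ascending order. Phrased with minimisers, a frame
  can be prolonged one vector at a time, as along a path in the tree.
\<close>

definition greedy_frame :: "nat \<Rightarrow> (nat \<Rightarrow> 'a) \<Rightarrow> bool" where
  "greedy_frame k v \<longleftrightarrow> (\<forall>i<k. v i \<in> tail_space v i \<and> norm (v i) = 1 \<and>
      (\<forall>x\<in>tail_space v i. quad (v i) * (x \<bullet> x) \<le> quad x))"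

lemma greedy_frame_inner:
  assumes "greedy_frame k v" "i < k" "j < k"
  shows "v i \<bullet> v j = (if i = j then 1 else 0)"
proof -
  have *: "v b \<bullet> v a = 0" if "a < b" "b < k" for a b
    using assms(1) that by (auto simp: greedy_frame_def mem_tail_space)
  show ?thesis
    using *[of i j] *[of j i] assms by (auto simp: greedy_frame_def norm_eq_1 inner_commute neq_iff)
qed

lemma greedy_frame_mono: "greedy_frame k v \<Longrightarrow> m \<le> k \<Longrightarrow> greedy_frame m v"
  by (auto simp: greedy_frame_def)

lemma greedy_frame_orthonormal:
  assumes "greedy_frame k v"
  shows "orthonormal (v ` {..<k})" "inj_on v {..<k}"
proof -
  show "orthonormal (v ` {..<k})"
    unfolding orthonormal_def pairwise_def orthogonal_def
    using greedy_frame_inner[OF assms] assms by (auto simp: greedy_frame_def)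
  show "inj_on v {..<k}"
    using greedy_frame_inner[OF assms] by (intro inj_onI) (metis lessThan_iff zero_neq_one)
qed

lemma dim_tail_space:
  assumes "greedy_frame k v"
  shows "dim (tail_space v k) = DIM('a) - k"
proof -
  have "dim (span (v ` {..<k})) = k"
    using orthonormal_card_eq_dim[OF greedy_frame_orthonormal(1)[OF assms] refl]
      card_image[OF greedy_frame_orthonormal(2)[OF assms]] by simp
  then show ?thesis
    using dim_orthogonal_comp_within[OF subspace_span subspace_UNIV subset_UNIV, of "v ` {..<k}"]
    by (simp add: tail_space_def)
qed

text \<open>
  The first order condition gives \<open>f (v i)\<close> no component in the tail space orthogonal to \<open>v i\<close>, and
  by induction it has none along the earlier vectors, which are eigenvectors of the symmetric \<open>f\<close>.
\<close>

lemma greedy_frame_eigenvector: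
  assumes v: "greedy_frame k v" and i: "i < k"
  shows "f (v i) = quad (v i) *\<^sub>R v i"
  using i
proof (induction i rule: less_induct)
  case (less i)
  have vi: "v i \<in> tail_space v i" "norm (v i) = 1"
    "\<And>x. x \<in> tail_space v i \<Longrightarrow> quad (v i) * (x \<bullet> x) \<le> quad x"
    using v less.prems by (auto simp: greedy_frame_def)
  have tail: "f (v i) \<in> tail_space v i"
    unfolding mem_tail_space
  proof (intro allI impI)
    fix j assume j: "j < i"
    then have "f (v j) = quad (v j) *\<^sub>R v j" using less by simp
    then have "f (v i) \<bullet> v j = quad (v j) * (v i \<bullet> v j)" by (simp add: symmetric)
    then show "f (v i) \<bullet> v j = 0" using vi(1) j by (simp add: mem_tail_space)
  qed
  define d where "d = f (v i) - quad (v i) *\<^sub>R v i"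
  have "d \<in> tail_space v i"
    using tail vi(1) subspace_tail_space subspace_diff subspace_scale unfolding d_def by blast
  moreover have "d \<bullet> v i = 0"
    using vi(2) by (simp add: d_def inner_diff_left quad_def inner_commute[of "f _"] norm_eq_1)
  ultimately have "d \<bullet> f (v i) = 0"
    using quad_min_orthogonal[OF subspace_tail_space vi] by blast
  with \<open>d \<bullet> v i = 0\<close> have "d \<bullet> d = 0"
    by (simp add: d_def inner_diff_right inner_diff_left)
  then show ?case by (simp add: d_def)
qed

lemma greedy_frame_extend_step:
  assumes "greedy_frame k v" "w \<in> tail_space v k" "norm w = 1"
    and "\<And>x. x \<in> tail_space v k \<Longrightarrow> quad w * (x \<bullet> x) \<le> quad x"
  shows "greedy_frame (Suc k) (v(k := w))"
proof -
  have "tail_space (v(k := w)) i = tail_space v i" if "i \<le> k" for i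
    using that by (intro tail_space_cong) auto
  then show ?thesis
    using assms by (auto simp: greedy_frame_def less_Suc_eq)
qed

lemma greedy_frame_extend:
  assumes "greedy_frame k v" "k \<le> m" "m \<le> DIM('a)"
  shows "\<exists>v'. greedy_frame m v' \<and> (\<forall>i<k. v' i = v i)"
  using assms(2,3)
proof (induction m rule: dec_induct)
  case base
  then show ?case using assms(1) by blast
next
  case (step m)
  then obtain v' where v': "greedy_frame m v'" "\<forall>i<k. v' i = v i"
    using Suc_leD by blast
  have "tail_space v' m \<noteq> {0}"
  proof
    assume "tail_space v' m = {0}"
    then have "DIM('a) - m = 0" using dim_tail_space[OF v'(1)] by simp
    then show False using step.prems by simp
  qed
  then obtain w where "w \<in> tail_space v' m" "norm w = 1"
    "\<And>x. x \<in> tail_space v' m \<Longrightarrow> quad w * (x \<bullet> x) \<le> quad x"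
    using quad_min_exists[OF subspace_tail_space] by metis
  then have "greedy_frame (Suc m) (v'(m := w))"
    by (intro greedy_frame_extend_step[OF v'(1)])
  moreover have "\<forall>i<k. (v'(m := w)) i = v i" using v'(2) step.hyps by simp
  ultimately show ?case by blast
qed

text \<open>
  This is the spectral theorem for symmetric operators, in the guise of successive minimisation.
\<close>

lemma greedy_frame_exists: "\<exists>v. greedy_frame DIM('a) v"
  using greedy_frame_extend[of 0 undefined "DIM('a)"] by (auto simp: greedy_frame_def)

lemma greedy_frame_quad_mono:
  assumes "greedy_frame k v" "i \<le> j" "j < k"
  shows "quad (v i) \<le> quad (v j)"
proof -
  have "v j \<in> tail_space v i" using assms tail_space_mono[OF assms(2), of v] by (auto simp: greedy_frame_def)
  then have "quad (v i) * (v j \<bullet> v j) \<le> quad (v j)" using assms by (auto simp: greedy_frame_def)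
  then show ?thesis using greedy_frame_inner[OF assms(1,3,3)] by simp
qed

lemma quad_le_on_head:
  assumes v: "greedy_frame k v" and m: "m < k" and x: "x \<in> span (v ` {..m})"
  shows "quad x \<le> quad (v m) * (x \<bullet> x)"
proof -
  interpret f: linear f by (rule linear)
  have "greedy_frame (Suc m) v" using v m greedy_frame_mono by simp
  note fr = greedy_frame_orthonormal[OF this, unfolded lessThan_Suc_atMost]
  have ex: "x = (\<Sum>i\<le>m. (x \<bullet> v i) *\<^sub>R v i)"
    using orthonormal_expand[OF fr(1) x] by (simp add: sum.reindex[OF fr(2)])
  have "x \<bullet> x = (\<Sum>i\<le>m. (x \<bullet> v i) *\<^sub>R v i) \<bullet> x" using ex by simp
  also have "\<dots> = (\<Sum>i\<le>m. (x \<bullet> v i)\<^sup>2)"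
    by (simp add: inner_sum_left power2_eq_square inner_commute[of "v _"])
  finally have xx: "x \<bullet> x = (\<Sum>i\<le>m. (x \<bullet> v i)\<^sup>2)" .
  have "quad x = x \<bullet> f (\<Sum>i\<le>m. (x \<bullet> v i) *\<^sub>R v i)" using ex by (simp add: quad_def)
  also have "\<dots> = (\<Sum>i\<le>m. (x \<bullet> v i) * (x \<bullet> f (v i)))"
    by (simp add: f.sum f.scale inner_sum_right)
  also have "\<dots> = (\<Sum>i\<le>m. quad (v i) * (x \<bullet> v i)\<^sup>2)"
    using greedy_frame_eigenvector[OF v] m
    by (intro sum.cong) (auto simp: power2_eq_square)
  also have "\<dots> \<le> (\<Sum>i\<le>m. quad (v m) * (x \<bullet> v i)\<^sup>2)"
    using greedy_frame_quad_mono[OF v _ m] by (intro sum_mono mult_right_mono) auto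
  finally show ?thesis by (simp add: xx sum_distrib_left)
qed

text \<open>
  The complement of the tail space is the span of \<open>v 0, \<dots>, v m\<close>, which \<open>f\<close> preserves and on which
  \<open>quad (v m)\<close> is the largest eigenvalue.
\<close>

lemma tail_space_separated:
  assumes v: "greedy_frame k v" and m: "m < k" and w: "w \<in> orthogonal_comp (tail_space v (Suc m))"
  shows "quad w \<le> quad (v m) * (w \<bullet> w)"
    and "u \<in> tail_space v (Suc m) \<Longrightarrow> u \<bullet> f w = 0"
proof -
  interpret f: linear f by (rule linear)
  have w': "w \<in> span (v ` {..m})"
    using w orthogonal_comp_self[OF subspace_span, of "v ` {..m}"]
    by (simp add: tail_space_def lessThan_Suc_atMost)
  then show "quad w \<le> quad (v m) * (w \<bullet> w)" using quad_le_on_head[OF v m] by blast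
  have "f w \<in> f ` span (v ` {..m})" using w' by blast
  also have "\<dots> = span (f ` v ` {..m})" using linear_span_image[OF linear] by metis
  also have "\<dots> \<subseteq> span (v ` {..m})"
  proof (intro span_minimal subspace_span subsetI)
    fix y assume "y \<in> f ` v ` {..m}"
    then obtain i where "i \<le> m" "y = quad (v i) *\<^sub>R v i"
      using greedy_frame_eigenvector[OF v] m by auto
    then show "y \<in> span (v ` {..m})" by (simp add: span_scale span_base)
  qed
  finally show "u \<bullet> f w = 0" if "u \<in> tail_space v (Suc m)"
    using that by (simp add: tail_space_def lessThan_Suc_atMost mem_orthogonal_comp)
qed

lemma dominant_self: "subspace V \<Longrightarrow> V \<noteq> {0} \<Longrightarrow> dominant V V"
  by (rule dominant_of_pairwise) (auto simp: mem_orthogonal_comp norm_eq_1)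

lemma dominant_tail_space:
  assumes v: "greedy_frame k v" and "i \<le> m" "m \<le> k" "m < DIM('a)"
  shows "dominant (tail_space v m) (tail_space v i)"
proof (cases "i = m")
  case True
  have "tail_space v m \<noteq> {0}"
  proof
    assume "tail_space v m = {0}"
    then have "DIM('a) - m = 0"
      using dim_tail_space[OF greedy_frame_mono[OF v \<open>m \<le> k\<close>]] by simp
    then show False using \<open>m < DIM('a)\<close> by simp
  qed
  with True show ?thesis using dominant_self subspace_tail_space by blast
next
  case False
  then obtain l where l: "m = Suc l" using \<open>i \<le> m\<close> by (cases m) auto
  have "quad (v l) * (u \<bullet> u) \<le> quad u" if "u \<in> tail_space v (Suc l)" for u
    using v l \<open>m \<le> k\<close> that tail_space_mono[of l "Suc l" v] by (auto simp: greedy_frame_def)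
  then show ?thesis
    using tail_space_separated[OF v, of l] \<open>m \<le> k\<close>
    unfolding dominant_def l by (intro exI[of _ "quad (v l)"]) auto
qed

text \<open>
  With a gap above \<open>quad (v m)\<close>, the value \<open>quad (v (Suc m))\<close> separates strictly, which is the
  equality case of Ky Fan's inequality.
\<close>

lemma trace_maximiser_unique:
  assumes v: "greedy_frame k v" and m: "i \<le> m" "Suc m < k" and gap: "quad (v m) < quad (v (Suc m))"
    and D: "subspace D" "D \<subseteq> tail_space v i" "dim D = dim (tail_space v (Suc m))"
    and max: "trace_on f (tail_space v (Suc m)) \<le> trace_on f D"
  shows "D = tail_space v (Suc m)"
proof (rule ky_fan(2)[OF subspace_tail_space subspace_tail_space _ D, where \<mu> = "quad (v (Suc m))"])
  show "tail_space v (Suc m) \<subseteq> tail_space v i" using m by (intro tail_space_mono) auto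
  have m': "m < k" using m by simp
  show "quad (v (Suc m)) * (u \<bullet> u) \<le> quad u" if "u \<in> tail_space v (Suc m)" for u
    using v m that by (auto simp: greedy_frame_def)
  show less: "quad w < quad (v (Suc m)) * (w \<bullet> w)"
    if "w \<in> tail_space v i \<inter> orthogonal_comp (tail_space v (Suc m))" "w \<noteq> 0" for w
  proof -
    have "0 < w \<bullet> w" using that(2) by simp
    from mult_strict_right_mono[OF gap this] show ?thesis
      using tail_space_separated(1)[OF v m', of w] that(1) by simp
  qed
  show "quad w \<le> quad (v (Suc m)) * (w \<bullet> w)"
    if "w \<in> tail_space v i \<inter> orthogonal_comp (tail_space v (Suc m))" for w
    using less[OF that] by (cases "w = 0") (auto simp: quad_def)
  show "u \<bullet> f w = 0"
    if "u \<in> tail_space v (Suc m)" "w \<in> tail_space v i \<inter> orthogonal_comp (tail_space v (Suc m))" for u w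
    using tail_space_separated(2)[OF v m', of w u] that by blast
qed (rule max)

end

section \<open>Perturbation by plane rotations\<close>

definition plane_rotation :: "'a::real_inner \<Rightarrow> 'a \<Rightarrow> real \<Rightarrow> 'a \<Rightarrow> 'a" where
  "plane_rotation u w t x =
     x + ((cos t - 1) * (u \<bullet> x) - sin t * (w \<bullet> x)) *\<^sub>R u
       + (sin t * (u \<bullet> x) + (cos t - 1) * (w \<bullet> x)) *\<^sub>R w"

lemma linear_plane_rotation: "linear (plane_rotation u w t)"
  unfolding plane_rotation_def
  by (intro linearI) (simp_all add: algebra_simps)

lemma plane_rotation_0: "plane_rotation u w 0 = id"
  by (simp add: plane_rotation_def fun_eq_iff)

lemma plane_rotation_fixes: "u \<bullet> x = 0 \<Longrightarrow> w \<bullet> x = 0 \<Longrightarrow> plane_rotation u w t x = x"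
  by (simp add: plane_rotation_def)

context
  fixes u w :: "'a::real_inner"
  assumes u: "norm u = 1" and w: "norm w = 1" and uw: "u \<bullet> w = 0"
begin

lemma plane_rotation_coords:
  "u \<bullet> plane_rotation u w t x = cos t * (u \<bullet> x) - sin t * (w \<bullet> x)"
  "w \<bullet> plane_rotation u w t x = sin t * (u \<bullet> x) + cos t * (w \<bullet> x)"
  using u w uw inner_commute[of w u]
  by (simp_all add: plane_rotation_def inner_add_right norm_eq_1 algebra_simps)

lemma plane_rotation_add:
  "plane_rotation u w (s + t) x = plane_rotation u w s (plane_rotation u w t x)"
  unfolding plane_rotation_def[of u w "s + t"] plane_rotation_def[of u w s] plane_rotation_coords
  unfolding plane_rotation_def cos_add sin_add by (simp add: algebra_simps)

lemma plane_rotation_self: "plane_rotation u w t u = cos t *\<^sub>R u + sin t *\<^sub>R w"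
  using u uw inner_commute[of w u] by (simp add: plane_rotation_def norm_eq_1 algebra_simps)

lemma orthogonal_transformation_plane_rotation: "orthogonal_transformation (plane_rotation u w t)"
proof -
  have "plane_rotation u w t x \<bullet> plane_rotation u w t y = x \<bullet> y" for x y
  proof -
    have "plane_rotation u w t x \<bullet> plane_rotation u w t y =
      x \<bullet> plane_rotation u w t y
       + ((cos t - 1) * (u \<bullet> x) - sin t * (w \<bullet> x)) * (cos t * (u \<bullet> y) - sin t * (w \<bullet> y))
       + (sin t * (u \<bullet> x) + (cos t - 1) * (w \<bullet> x)) * (sin t * (u \<bullet> y) + cos t * (w \<bullet> y))"
      by (subst (1) plane_rotation_def) (simp add: inner_add_left plane_rotation_coords)
    also have "x \<bullet> plane_rotation u w t y = x \<bullet> y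
       + ((cos t - 1) * (u \<bullet> y) - sin t * (w \<bullet> y)) * (u \<bullet> x)
       + (sin t * (u \<bullet> y) + (cos t - 1) * (w \<bullet> y)) * (w \<bullet> x)"
      by (simp add: plane_rotation_def inner_add_right inner_commute)
    finally have "plane_rotation u w t x \<bullet> plane_rotation u w t y
      = x \<bullet> y + ((sin t)\<^sup>2 + (cos t)\<^sup>2 - 1) * ((u \<bullet> x) * (u \<bullet> y) + (w \<bullet> x) * (w \<bullet> y))"
      by (simp add: algebra_simps power2_eq_square
          del: sin_cos_squared_add sin_cos_squared_add2 sin_cos_squared_add3)
    then show ?thesis by simp
  qed
  then show ?thesis
    by (simp add: orthogonal_transformation_def linear_plane_rotation)
qed

end

context symmetric_operator begin

text \<open>
  Complete \<open>u\<close> to an orthonormal basis of \<open>N\<close>. Its other vectors are orthogonal to \<open>u\<close> and \<open>w\<close>,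
  so the rotation moves only \<open>u\<close>.
\<close>

lemma trace_on_plane_rotation:
  assumes N: "subspace N" and u: "u \<in> N" "norm u = 1" and w: "w \<in> orthogonal_comp N" "norm w = 1"
  shows "trace_on f (plane_rotation u w t ` N)
    = trace_on f N - quad u + quad (cos t *\<^sub>R u + sin t *\<^sub>R w)"
proof -
  have wN: "w \<bullet> x = 0" if "x \<in> N" for x using w(1) that by (simp add: mem_orthogonal_comp)
  have uw: "u \<bullet> w = 0" using wN[OF u(1)] by (simp add: inner_commute)
  note R = orthogonal_transformation_plane_rotation[OF u(2) w(2) uw, of t]
  have "orthonormal {u}" using u(2) by (simp add: orthonormal_def pairwise_def)
  then obtain B where B: "orthonormal B" "{u} \<subseteq> B" "span B = N"
    using orthonormal_extend[of "{u}" N] u(1) N by auto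
  have fin: "finite B" using B(1) orthonormal_finite by blast
  let ?R = "plane_rotation u w t"
  have inj: "inj_on ?R B"
    using orthogonal_transformation_inj[OF R] inj_on_subset by blast
  have "orthonormal (?R ` B)"
    using B(1) R
    unfolding orthonormal_def pairwise_def orthogonal_def orthogonal_transformation_def norm_eq_1
    by auto
  moreover have "span (?R ` B) = ?R ` N"
    using linear_span_image[OF linear_plane_rotation] B(3) by metis
  ultimately have "trace_on f (?R ` N) = (\<Sum>b\<in>B. quad (?R b))"
    using trace_on_eq[OF linear] by (simp add: sum.reindex[OF inj] quad_def)
  also have "\<dots> = quad (?R u) + (\<Sum>b\<in>B - {u}. quad (?R b))"
    using B(2) fin by (simp add: sum.remove)
  also have "(\<Sum>b\<in>B - {u}. quad (?R b)) = (\<Sum>b\<in>B - {u}. quad b)"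
  proof (rule sum.cong[OF refl])
    fix b assume b: "b \<in> B - {u}"
    then have "w \<bullet> b = 0" using wN B(3) span_base by blast
    moreover have "u \<bullet> b = 0" using orthonormal_inner[OF B(1), of u b] B(2) b by auto
    ultimately show "quad (?R b) = quad b" by (simp add: plane_rotation_fixes)
  qed
  also have "\<dots> = trace_on f N - quad u"
    using trace_on_eq[OF linear B(1,3)] sum.remove[OF fin, of u quad] B(2) by (simp add: quad_def)
  finally show ?thesis by (simp add: plane_rotation_self[OF u(2) w(2) uw])
qed

text \<open>
  The derivative at \<open>t = 0\<close> is \<open>2 * (u \<bullet> f w)\<close>. Once it vanishes, what remains of the increment
  is \<open>(sin t)\<^sup>2 * (quad w - quad u)\<close>.
\<close>

lemma quad_rotation_local_max:
  assumes e: "0 < e" and max: "\<And>t. \<bar>t\<bar> < e \<Longrightarrow> quad (cos t *\<^sub>R u + sin t *\<^sub>R w) \<le> quad u"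
  shows "u \<bullet> f w = 0" "quad w \<le> quad u"
proof -
  let ?\<phi> = "\<lambda>t. quad (cos t *\<^sub>R u + sin t *\<^sub>R w)"
  have "(?\<phi> has_field_derivative 2 * (u \<bullet> f w)) (at 0)"
    unfolding quad_combination by (auto intro!: derivative_eq_intros)
  then have "2 * (u \<bullet> f w) = 0"
    by (rule DERIV_local_max[OF _ e]) (use max in auto)
  then show uw: "u \<bullet> f w = 0" by simp
  obtain t where t: "0 < t" "t < e" "t < pi"
    using field_lbound_gt_zero[of e pi] e pi_gt_zero by auto
  have "(cos t)\<^sup>2 * quad u + (sin t)\<^sup>2 * quad w \<le> quad u"
    using max[of t] t uw by (simp add: quad_combination)
  then have "(sin t)\<^sup>2 * quad w \<le> (sin t)\<^sup>2 * quad u"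
    by (simp add: cos_squared_eq algebra_simps)
  moreover have "0 < (sin t)\<^sup>2" using sin_gt_zero[of t] t by simp
  ultimately show "quad w \<le> quad u" by (simp only: mult_le_cancel_left_pos)
qed

end

section \<open>Great spheres\<close>

lemma span_great_sphere: "subspace N \<Longrightarrow> span (great_sphere N) = N"
proof
  assume N: "subspace N"
  show "span (great_sphere N) \<subseteq> N"
    using N by (intro span_minimal) (auto simp: great_sphere_def)
  show "N \<subseteq> span (great_sphere N)"
  proof
    fix x assume x: "x \<in> N"
    show "x \<in> span (great_sphere N)"
    proof (cases "x = 0")
      case False
      then have "x /\<^sub>R norm x \<in> great_sphere N"
        using x N by (simp add: great_sphere_def subspace_scale)
      then have "norm x *\<^sub>R (x /\<^sub>R norm x) \<in> span (great_sphere N)"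
        by (intro span_scale span_base)
      then show ?thesis using False by simp
    qed (simp add: span_zero)
  qed
qed

lemma great_sphere_subset_iff:
  "subspace N \<Longrightarrow> subspace D \<Longrightarrow> great_sphere N \<subseteq> great_sphere D \<longleftrightarrow> N \<subseteq> D"
  by (metis great_sphere_def inf_mono order_refl span_great_sphere span_mono)

lemma great_sphere_eq_iff:
  "subspace N \<Longrightarrow> subspace D \<Longrightarrow> great_sphere N = great_sphere D \<longleftrightarrow> N = D"
  by (metis span_great_sphere)

lemma image_great_sphere:
  assumes "orthogonal_transformation h"
  shows "h ` great_sphere N = great_sphere (h ` N)"
  using orthogonal_transformation_norm[OF assms] by (force simp: great_sphere_def)

lemma tot_geodesic_great_sphere:
  assumes "subspace V"
  shows "tot_geodesic (great_sphere V) = great_sphere ` {N. subspace N \<and> N \<subseteq> V \<and> 2 \<le> dim N}"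
proof -
  have eq: "(\<exists>k\<ge>1. subsphere k S) \<longleftrightarrow> (\<exists>N. subspace N \<and> 2 \<le> dim N \<and> S = great_sphere N)" 
    for S :: "(real^'n) set"
  proof
    assume "\<exists>N. subspace N \<and> 2 \<le> dim N \<and> S = great_sphere N"
    then obtain N where "subspace N" "2 \<le> dim N" "S = great_sphere N" by blast
    then show "\<exists>k\<ge>1. subsphere k S"
      unfolding subsphere_def by (intro exI[of _ "dim N - 1"]) auto
  next
    assume "\<exists>k\<ge>1. subsphere k S"
    then show "\<exists>N. subspace N \<and> 2 \<le> dim N \<and> S = great_sphere N"
      by (force simp: subsphere_def)
  qed
  show ?thesis
    unfolding tot_geodesic_def eq using great_sphere_subset_iff[OF _ assms] by auto
qed

lemma orthogonal_transformation_of_matrix: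
  "orthogonal_matrix g \<longleftrightarrow> orthogonal_transformation (\<lambda>x. g *v (x::real^'n))"
  by (simp add: orthogonal_transformation_matrix matrix_of_matrix_vector_mul)

text \<open>
  An orthogonal map that fixes the complement of \<open>V\<close> pointwise maps \<open>V\<close> to itself.
\<close>

lemma rotation_preserves_span:
  assumes V: "subspace V" and g: "g \<in> rotations (great_sphere V)" and N: "N \<subseteq> V" "subspace N"
  shows "subspace ((*v) g ` N)" "(*v) g ` N \<subseteq> V" "dim ((*v) g ` N) = dim N"
proof -
  have orth: "orthogonal_transformation ((*v) g)"
    and fixed: "\<And>w. w \<in> orthogonal_comp V \<Longrightarrow> g *v w = w"
    using g unfolding rotations_def span_great_sphere[OF V]
    by (auto simp: rotation_matrix_def orthogonal_transformation_of_matrix)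
  have lin: "linear ((*v) g)" using orth orthogonal_transformation_def by blast
  show "subspace ((*v) g ` N)" using linear_subspace_image[OF lin N(2)] .
  show "dim ((*v) g ` N) = dim N"
    using orthogonal_transformation_inj[OF orth] inj_on_subset
    by (intro dim_image_eq lin) blast
  have "g *v x \<in> V" if "x \<in> V" for x
  proof -
    have "(g *v x) \<bullet> w = 0" if w: "w \<in> orthogonal_comp V" for w
    proof -
      have "(g *v x) \<bullet> w = (g *v x) \<bullet> (g *v w)" by (simp add: fixed[OF w])
      also have "\<dots> = x \<bullet> w" using orth by (simp add: orthogonal_transformation_def)
      also have "\<dots> = 0" using w \<open>x \<in> V\<close> by (simp add: mem_orthogonal_comp inner_commute[of x])
      finally show ?thesis .
    qed
    then have "g *v x \<in> orthogonal_comp (orthogonal_comp V)" by (simp add: mem_orthogonal_comp)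
    then show ?thesis by (simp add: orthogonal_comp_self[OF V])
  qed
  then show "(*v) g ` N \<subseteq> V" using N by auto
qed

lemma plane_rotation_in_rotations:
  assumes V: "subspace V" and u: "u \<in> V" "norm u = 1" and w: "w \<in> V" "norm w = 1" and uw: "u \<bullet> w = 0"
    and g: "g \<in> rotations (great_sphere V)"
  shows "matrix (plane_rotation u w t) ** g \<in> rotations (great_sphere V)"
proof -
  let ?R = "\<lambda>t. matrix (plane_rotation u w t)"
  have orth: "orthogonal_matrix (?R t)" for t
    using orthogonal_transformation_plane_rotation[OF u(2) w(2) uw]
      orthogonal_transformation_matrix by blast
  have app: "?R t *v x = plane_rotation u w t x" for t x
    by (simp add: matrix_works linear_plane_rotation)
  \<comment> \<open>The rotation by \<open>t\<close> is the square of the one by \<open>t / 2\<close>, so its determinant is a square, and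
    hence not \<open>-1\<close>.\<close>
  have "?R t = ?R (t/2) ** ?R (t/2)"
    using plane_rotation_add[OF u(2) w(2) uw, of "t/2" "t/2"]
    by (simp add: matrix_eq app matrix_vector_mul_assoc[symmetric])
  then have "det (?R t) = (det (?R (t/2)))\<^sup>2" by (simp add: det_mul power2_eq_square)
  then have "det (?R t) = 1" using det_orthogonal_matrix[OF orth[of "t/2"]] by auto
  moreover have "?R t *v x = x" if "x \<in> orthogonal_comp V" for x
    using that u w by (simp add: app mem_orthogonal_comp inner_commute plane_rotation_fixes)
  ultimately show ?thesis
    using g orth[of t] unfolding rotations_def span_great_sphere[OF V]
    by (auto simp: rotation_matrix_def det_mul orthogonal_matrix_mul
        matrix_vector_mul_assoc[symmetric])
qed

text \<open>
  Local minimality is tested along the curve of matrices \<open>t \<mapsto> R t ** g\<close>, which has to be continuous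
  in the topology of the matrix space.
\<close>

lemma continuous_plane_rotation_matrix:
  fixes u w :: "real^'n" and g :: "real^'n^'n"
  shows "continuous_on UNIV (\<lambda>t. matrix (plane_rotation u w t) ** g)"
  unfolding matrix_matrix_mult_def matrix_def plane_rotation_def
  by (simp, intro continuous_intros)

section \<open>The projection distance as a trace\<close>

text \<open>
  The line through any point of the great sphere stays in \<open>N\<close>, and \<open>p\<close> is the point of \<open>N\<close> nearest to
  \<open>p + r\<close>. The line through \<open>p\<close> attains the distance. If \<open>p = 0\<close>, every line does,
  and one exists since \<open>N \<noteq> {0}\<close>.
\<close>

lemma proj_dist_set_great_sphere:
  fixes p r :: "real^'n"
  assumes N: "subspace N" "N \<noteq> {0}" and p: "p \<in> N" and r: "r \<in> orthogonal_comp N"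
  shows "proj_dist_set (p + r) (great_sphere N) = norm r"
proof -
  have rN: "r \<bullet> y = 0" if "y \<in> N" for y using r that by (simp add: mem_orthogonal_comp)
  have ge: "norm r \<le> proj_dist (p + r) v" if v: "v \<in> great_sphere N" for v
  proof -
    have "norm r \<le> dist (p + r) y" if "y \<in> span {v}" for y
    proof -
      have "span {v} \<subseteq> N" using v N(1) by (intro span_minimal) (auto simp: great_sphere_def)
      then have "p - y \<in> N" using that p N(1) subspace_diff by blast
      then have "orthogonal r (p - y)" using rN by (simp add: orthogonal_def)
      then have "(norm (r + (p - y)))\<^sup>2 = (norm r)\<^sup>2 + (norm (p - y))\<^sup>2"
        by (rule norm_add_Pythagorean)
      then have "(norm r)\<^sup>2 \<le> (norm (r + (p - y)))\<^sup>2" by simp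
      then have "norm r \<le> norm (r + (p - y))" by (rule power2_le_imp_le) simp
      then show ?thesis by (simp add: dist_norm algebra_simps)
    qed
    moreover have "span {v} \<noteq> {}" using span_zero by blast
    ultimately show ?thesis
      unfolding proj_dist_def by (simp add: infdist_notempty cINF_greatest)
  qed
  obtain x where x: "x \<in> N" "x \<noteq> 0" "p \<in> span {x}"
  proof (cases "p = 0")
    case True
    then show ?thesis using that N subspace_0 span_zero by blast
  next
    case False
    then show ?thesis using that p span_base by blast
  qed
  define v where "v = x /\<^sub>R norm x"
  have v: "v \<in> great_sphere N" using x N(1) by (simp add: v_def great_sphere_def subspace_scale)
  have "x = norm x *\<^sub>R v" using x by (simp add: v_def)
  then have "x \<in> span {v}" by (metis insertI1 span_base span_scale)
  then have "p \<in> span {v}" using x(3) span_minimal[of "{x}" "span {v}"] by auto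
  then have "proj_dist (p + r) v \<le> dist (p + r) p"
    unfolding proj_dist_def by (rule infdist_le)
  then have "proj_dist (p + r) v = norm r" using ge[OF v] by (simp add: dist_norm)
  then show ?thesis
    unfolding proj_dist_set_def using v ge by (intro cInf_eq_minimum) force+
qed

definition gram :: "real^'d^'n \<Rightarrow> real^'n \<Rightarrow> real^'n" where
  "gram X x = (X ** transpose X) *v x"

lemma inner_gram: "x \<bullet> gram X y = (transpose X *v x) \<bullet> (transpose X *v y)"
  by (simp add: gram_def matrix_vector_mul_assoc[symmetric] dot_lmul_matrix[symmetric])

lemma symmetric_operator_gram: "symmetric_operator (gram X)"
proof (rule symmetric_operator.intro)
  show "linear (gram X)" unfolding gram_def[abs_def] by simp
  show "gram X x \<bullet> y = x \<bullet> gram X y" for x y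
    using inner_gram[of y X x] inner_gram[of x X y] by (simp add: inner_commute)
qed

lemma inner_gram_self: "x \<bullet> gram X x = (\<Sum>j\<in>UNIV. (column j X \<bullet> x)\<^sup>2)"
proof -
  have "(transpose X *v x) $ j = column j X \<bullet> x" for j
    by (simp add: matrix_vector_mult_def transpose_def column_def inner_vec_def)
  then show ?thesis
    unfolding inner_gram inner_vec_def[of "transpose X *v x"]
    by (simp only: inner_real_def power2_eq_square)
qed

text \<open>
  The locale only fixes the data, so that the notions for symmetric operators can be used for
  the operator of \<open>X\<close> without naming it each time.
\<close>

locale data_matrix =
  fixes X :: "real^'d^'n"
begin

sublocale symmetric_operator "gram X" by (rule symmetric_operator_gram)

lemma quad_nonneg: "0 \<le> quad x"
  unfolding quad_def inner_gram_self by (rule sum_nonneg) simp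

text \<open>
  By Pythagoras, \<open>x\<close> has squared distance \<open>(norm x)\<^sup>2 - (\<Sum>b\<in>B. (x \<bullet> b)\<^sup>2)\<close> from the span of an
  orthonormal set \<open>B\<close>, and summing \<open>(x \<bullet> b)\<^sup>2\<close> over the data gives the quadratic form of \<open>X X\<^sup>T\<close>
  at \<open>b\<close>.
\<close>

lemma data_dist_great_sphere:
  assumes N: "subspace N" "N \<noteq> {0}"
  shows "data_dist X (great_sphere N)
    = sqrt ((\<Sum>j\<in>UNIV. (norm (column j X))\<^sup>2) - trace_on (gram X) N)"
proof -
  obtain B where B: "orthonormal B" "span B = N" using orthonormal_basis_exists[OF N(1)] .
  have "(proj_dist_set x (great_sphere N))\<^sup>2 = (norm x)\<^sup>2 - (\<Sum>b\<in>B. (x \<bullet> b)\<^sup>2)" for x :: "real^'n"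
  proof -
    obtain p r where pr: "p \<in> N" "r \<in> orthogonal_comp N" "x = p + r"
      using orthogonal_decomposition[OF N(1) subspace_UNIV subset_UNIV UNIV_I] by auto
    have "r \<bullet> b = 0" if "b \<in> N" for b using pr(2) that by (simp add: mem_orthogonal_comp)
    then have xb: "x \<bullet> b = p \<bullet> b" if "b \<in> N" for b using that pr(3) by (simp add: inner_add_left)
    have "p \<bullet> p = (\<Sum>b\<in>B. (p \<bullet> b) *\<^sub>R b) \<bullet> p"
      using orthonormal_expand[OF B(1), of p] B(2) pr(1) by simp
    also have "\<dots> = (\<Sum>b\<in>B. (x \<bullet> b)\<^sup>2)"
      using xb B(2) span_base[of _ B]
      unfolding inner_sum_left by (simp add: power2_eq_square inner_commute[of _ p])
    finally have "(norm p)\<^sup>2 = (\<Sum>b\<in>B. (x \<bullet> b)\<^sup>2)" by (simp add: power2_norm_eq_inner)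
    moreover have "(norm x)\<^sup>2 = (norm p)\<^sup>2 + (norm r)\<^sup>2"
      unfolding pr(3) using pr by (intro norm_add_Pythagorean) (simp add: orthogonal_comp_def)
    ultimately show ?thesis
      using proj_dist_set_great_sphere[OF N pr(1,2)] pr(3) by simp
  qed
  then have "(\<Sum>j\<in>UNIV. (proj_dist_set (column j X) (great_sphere N))\<^sup>2)
    = (\<Sum>j\<in>UNIV. (norm (column j X))\<^sup>2) - (\<Sum>b\<in>B. \<Sum>j\<in>UNIV. (column j X \<bullet> b)\<^sup>2)"
    by (simp add: sum_subtractf sum.swap[of _ B])
  then show ?thesis
    by (simp add: data_dist_def L2_set_def trace_on_eq[OF linear B] inner_gram_self)
qed

lemma data_dist_le_iff:
  assumes "subspace N" "N \<noteq> {0}" "subspace D" "D \<noteq> {0}"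
  shows "data_dist X (great_sphere N) \<le> data_dist X (great_sphere D)
    \<longleftrightarrow> trace_on (gram X) D \<le> trace_on (gram X) N"
  using assms by (simp add: data_dist_great_sphere)

section \<open>Local minimality under rotations\<close>

text \<open>
  Composing \<open>g\<close> with plane rotations inside \<open>V\<close> gives nearby competitors \<open>h t\<close>, along which only
  the contribution of one basis vector to the trace varies.
\<close>

lemma dominant_of_local_argmin:
  assumes V: "subspace V" and N: "subspace N" "N \<subseteq> V" "N \<noteq> {0}"
    and g: "local_argmin_on (rotations (great_sphere V)) (\<lambda>h. data_dist X ((*v) h ` great_sphere N)) g"
  shows "dominant ((*v) g ` N) V"
proof -
  define G where "G = rotations (great_sphere V)"
  define gN where "gN = (*v) g ` N"
  have gG: "g \<in> G" and ev: "\<forall>\<^sub>F h in at g within G.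
      data_dist X ((*v) g ` great_sphere N) \<le> data_dist X ((*v) h ` great_sphere N)"
    using g by (auto simp: local_argmin_on_def G_def)
  have image: "(*v) h ` great_sphere N = great_sphere ((*v) h ` N)"
    "subspace ((*v) h ` N)" "(*v) h ` N \<subseteq> V" "(*v) h ` N \<noteq> {0}" if "h \<in> G" for h
  proof -
    have "orthogonal_transformation ((*v) h)"
      using that unfolding G_def rotations_def rotation_matrix_def
      by (auto simp: orthogonal_transformation_of_matrix)
    then show "(*v) h ` great_sphere N = great_sphere ((*v) h ` N)" by (rule image_great_sphere)
    note P = rotation_preserves_span[OF V that[unfolded G_def] N(2,1)]
    show "subspace ((*v) h ` N)" "(*v) h ` N \<subseteq> V" using P by auto
    show "(*v) h ` N \<noteq> {0}" using P(3) N(3) dim_eq_0[of N] subspace_0[OF N(1)] by auto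
  qed
  obtain d where d: "d > 0" "\<And>h. h \<in> G \<Longrightarrow> dist h g < d \<Longrightarrow>
      data_dist X ((*v) g ` great_sphere N) \<le> data_dist X ((*v) h ` great_sphere N)"
    using ev unfolding eventually_at by (metis order_refl)
  show ?thesis
    unfolding gN_def[symmetric]
  proof (rule dominant_of_pairwise[OF _ _ V])
    show sub: "subspace gN" and ne: "gN \<noteq> {0}" using image[OF gG] by (auto simp: gN_def)
    fix u w assume u: "u \<in> gN" "norm u = 1" and w: "w \<in> V \<inter> orthogonal_comp gN" "norm w = 1"
    have uV: "u \<in> V" using u(1) image(3)[OF gG] by (auto simp: gN_def)
    have uw: "u \<bullet> w = 0" using u(1) w(1) by (auto simp: mem_orthogonal_comp inner_commute)
    define h where "h t = matrix (plane_rotation u w t) ** g" for t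
    have hG: "h t \<in> G" for t
      unfolding G_def h_def
      using plane_rotation_in_rotations[OF V uV u(2) _ w(2) uw gG[unfolded G_def]] w(1) by blast
    have h0: "h 0 = g"
      unfolding h_def plane_rotation_0 by (simp add: matrix_id_mat_1)
    have hN: "(*v) (h t) ` N = plane_rotation u w t ` gN" for t
      unfolding h_def gN_def image_image matrix_vector_mul_assoc[symmetric]
      by (simp add: matrix_works linear_plane_rotation)
    have "isCont h 0"
      using continuous_plane_rotation_matrix[of u w g] unfolding h_def[symmetric]
      by (simp add: continuous_on_eq_continuous_at)
    then obtain e where e: "e > 0" "\<And>t. \<bar>t\<bar> < e \<Longrightarrow> dist (h t) g < d"
      using d(1) unfolding continuous_at_eps_delta h0 by auto
    have "quad (cos t *\<^sub>R u + sin t *\<^sub>R w) \<le> quad u" if "\<bar>t\<bar> < e" for t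
    proof -
      have "data_dist X (great_sphere gN) \<le> data_dist X (great_sphere ((*v) (h t) ` N))"
        using d(2)[OF hG e(2)[OF that]] image(1)[OF gG] image(1)[OF hG] by (simp add: gN_def)
      then have "trace_on (gram X) (plane_rotation u w t ` gN) \<le> trace_on (gram X) gN"
        using data_dist_le_iff[OF sub ne image(2)[OF hG] image(4)[OF hG]] hN by simp
      then show ?thesis
        using trace_on_plane_rotation[OF sub u _ w(2)] w(1) by simp
    qed
    from quad_rotation_local_max[OF e(1) this] show "u \<bullet> gram X w = 0 \<and> quad w \<le> quad u" by blast
  qed
qed

text \<open>
  Conversely to the preceding lemma, a dominant subspace is a global minimiser among all subspaces
  of its dimension in \<open>V\<close>, and so the identity is a local minimum for it.
\<close>

lemma symm_space_approx_great_sphere: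
  assumes V: "subspace V"
  shows "symm_space_approx X (great_sphere V)
    = great_sphere ` {N. subspace N \<and> N \<subseteq> V \<and> 2 \<le> dim N \<and> dominant N V}"
proof (intro equalityI subsetI)
  fix C assume "C \<in> symm_space_approx X (great_sphere V)"
  then obtain g N where N: "subspace N" "N \<subseteq> V" "2 \<le> dim N" and C: "C = (*v) g ` great_sphere N"
    and min: "local_argmin_on (rotations (great_sphere V)) (\<lambda>h. data_dist X ((*v) h ` great_sphere N)) g"
    unfolding symm_space_approx_def tot_geodesic_great_sphere[OF V] by blast
  have g: "g \<in> rotations (great_sphere V)" using min by (simp add: local_argmin_on_def)
  then have "orthogonal_transformation ((*v) g)"
    unfolding rotations_def rotation_matrix_def by (auto simp: orthogonal_transformation_of_matrix)
  then have "C = great_sphere ((*v) g ` N)" unfolding C by (rule image_great_sphere)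
  moreover have "dominant ((*v) g ` N) V"
    using dominant_of_local_argmin[OF V N(1,2) _ min] N(3) by fastforce
  ultimately show "C \<in> great_sphere ` {N. subspace N \<and> N \<subseteq> V \<and> 2 \<le> dim N \<and> dominant N V}"
    using rotation_preserves_span[OF V g N(2,1)] N(3) by auto
next
  fix C assume "C \<in> great_sphere ` {N. subspace N \<and> N \<subseteq> V \<and> 2 \<le> dim N \<and> dominant N V}"
  then obtain N where N: "subspace N" "N \<subseteq> V" "2 \<le> dim N" "dominant N V" and C: "C = great_sphere N"
    by blast
  have N0: "N \<noteq> {0}" using N(3) by auto
  have le: "data_dist X (great_sphere N) \<le> data_dist X ((*v) h ` great_sphere N)"
    if h: "h \<in> rotations (great_sphere V)" for h
  proof -
    have "orthogonal_transformation ((*v) h)"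
      using h unfolding rotations_def rotation_matrix_def
      by (auto simp: orthogonal_transformation_of_matrix)
    moreover note P = rotation_preserves_span[OF V h N(2,1)]
    moreover have "(*v) h ` N \<noteq> {0}"
      using P(3) N0 dim_eq_0[of N] subspace_0[OF N(1)] by auto
    ultimately show ?thesis
      using dominant_trace_max[OF V N(1,2) P N(4)] data_dist_le_iff[OF N(1) N0 P(1)]
      by (simp add: image_great_sphere)
  qed
  have "mat 1 \<in> rotations (great_sphere V)"
    by (simp add: rotations_def rotation_matrix_def orthogonal_matrix_id)
  then have "local_argmin_on (rotations (great_sphere V))
      (\<lambda>h. data_dist X ((*v) h ` great_sphere N)) (mat 1)"
    using le unfolding local_argmin_on_def by (auto simp: eventually_at intro!: exI[of _ 1])
  moreover have "C = (*v) (mat 1) ` great_sphere N" by (simp add: C)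
  ultimately show "C \<in> symm_space_approx X (great_sphere V)"
    unfolding symm_space_approx_def tot_geodesic_great_sphere[OF V] using N by blast
qed

section \<open>The tree\<close>

text \<open>
  A dominant subspace of codimension above one is not a child, since it sits strictly between: it
  is contained in the dominant hyperplane orthogonal to a minimiser of the form on \<open>V\<close>. In
  codimension one, dimensions leave no room for anything in between.
\<close>

lemma psa_children_great_sphere:
  assumes V: "subspace V"
  shows "psa_children X (great_sphere V) = great_sphere `
    {N. subspace N \<and> N \<subseteq> V \<and> 2 \<le> dim N \<and> Suc (dim N) = dim V \<and> dominant N V}"
proof -
  define A where "A = {N. subspace N \<and> N \<subseteq> V \<and> 2 \<le> dim N \<and> dominant N V}"
  have approx: "symm_space_approx X (great_sphere V) = great_sphere ` A"
    unfolding A_def by (rule symm_space_approx_great_sphere[OF V])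
  have psub: "great_sphere N \<subset> great_sphere D \<longleftrightarrow> N \<subset> D" if "subspace N" "subspace D" for N D
    using that by (simp add: psubset_eq great_sphere_subset_iff great_sphere_eq_iff)
  have "great_sphere N \<in> psa_children X (great_sphere V) \<longleftrightarrow> Suc (dim N) = dim V" if N: "N \<in> A" for N
  proof -
    have sN: "subspace N" "N \<subseteq> V" "2 \<le> dim N" "dominant N V" using N by (auto simp: A_def)
    have iff: "great_sphere N \<in> psa_children X (great_sphere V) \<longleftrightarrow> N \<noteq> V \<and> \<not> (\<exists>D\<in>A. N \<subset> D \<and> D \<subset> V)"
    proof -
      have *: "great_sphere N \<subset> great_sphere D \<and> great_sphere D \<subset> great_sphere V \<longleftrightarrow> N \<subset> D \<and> D \<subset> V"
        if "D \<in> A" for D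
        using that psub[OF sN(1), of D] psub[OF _ V, of D] unfolding A_def by blast
      have "(\<exists>D\<in>A. N \<subset> D \<and> D \<subset> V)
          \<longleftrightarrow> (\<exists>D\<in>A. great_sphere N \<subset> great_sphere D \<and> great_sphere D \<subset> great_sphere V)"
        by (rule bex_cong[OF refl *[symmetric]])
      then show ?thesis
        unfolding psa_children_def approx
        using imageI[OF N, of great_sphere] by (simp add: great_sphere_eq_iff[OF sN(1) V])
    qed
    show ?thesis
    proof
      assume *: "Suc (dim N) = dim V"
      have "dim N < dim D" "dim D < dim V" if "subspace D" "N \<subset> D" "D \<subset> V" for D
        using that sN(1) V dim_psubset[of N D] dim_psubset[of D V] span_eq_iff by metis+
      then show "great_sphere N \<in> psa_children X (great_sphere V)"
        unfolding iff using * by (fastforce simp: A_def)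
    next
      assume ch: "great_sphere N \<in> psa_children X (great_sphere V)"
      then have "N \<noteq> V" unfolding iff by blast
      define W where "W = V \<inter> orthogonal_comp N"
      have dW: "dim W + dim N = dim V"
        unfolding W_def by (rule dim_orthogonal_comp_within[OF sN(1) V sN(2)])
      have sW: "subspace W"
        unfolding W_def using V subspace_orthogonal_comp subspace_inter by blast
      have "W \<noteq> {0}"
      proof
        assume "W = {0}"
        then have "dim N = dim V" using dW by simp
        then show False using subspace_dim_equal[OF sN(1) V sN(2)] \<open>N \<noteq> V\<close> by simp
      qed
      then obtain w where w: "w \<in> W" "norm w = 1" "\<And>x. x \<in> W \<Longrightarrow> quad w * (x \<bullet> x) \<le> quad x"
        using quad_min_exists[OF sW] by metis
      define D where "D = V \<inter> orthogonal_comp (span {w})"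
      have "dominant D V"
        unfolding D_def
        using dominant_hyperplane_min[OF V sN(1,2,4) w[unfolded W_def]] w(1,2)
        by (intro dominant_hyperplane[OF V]) (auto simp: W_def)
      moreover have sD: "subspace D"
        unfolding D_def using V subspace_orthogonal_comp subspace_inter by blast
      moreover have ND: "N \<subseteq> D"
      proof -
        have "x \<bullet> w = 0" if "x \<in> N" for x
          using w(1) that by (simp add: W_def mem_orthogonal_comp inner_commute[of x])
        then show ?thesis using sN(2) by (auto simp: D_def mem_orthogonal_comp_span)
      qed
      moreover have "D \<subseteq> V" by (simp add: D_def)
      moreover have "2 \<le> dim D" using sN(3) dim_subset[OF ND] by (rule order_trans)
      ultimately have "D \<in> A" unfolding A_def by blast
      have "w \<noteq> 0" using w(2) by auto
      then have dD: "Suc (dim D) = dim V"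
        using dim_orthogonal_comp_within[OF subspace_span V, of "{w}"] w(1) V
        by (simp add: D_def W_def span_minimal)
      then have "D \<noteq> V" by (intro notI) simp
      with \<open>D \<subseteq> V\<close> have "D \<subset> V" by blast
      then have "N = D" using ch \<open>D \<in> A\<close> ND unfolding iff by blast
      then show "Suc (dim N) = dim V" using dD by simp
    qed
  qed
  moreover have "psa_children X (great_sphere V) \<subseteq> great_sphere ` A"
    unfolding approx[symmetric] psa_children_def by blast
  ultimately have "psa_children X (great_sphere V) = great_sphere ` {N \<in> A. Suc (dim N) = dim V}"
    by blast
  also have "{N \<in> A. Suc (dim N) = dim V}
    = {N. subspace N \<and> N \<subseteq> V \<and> 2 \<le> dim N \<and> Suc (dim N) = dim V \<and> dominant N V}"
    by (auto simp: A_def)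
  finally show ?thesis .
qed

lemma principal_sphere_tail_space: "principal_sphere v m = great_sphere (tail_space v m)"
  by (simp add: principal_sphere_def tail_space_def)

text \<open>
  The complement of a child in its parent is a line, and a unit vector on it prolongs the frame.
\<close>

lemma child_of_principal_sphere:
  assumes v: "greedy_frame m v" and C: "C \<in> psa_children X (principal_sphere v m)"
  obtains w where "greedy_frame (Suc m) (v(m := w))" "C = principal_sphere (v(m := w)) (Suc m)"
    "2 \<le> dim (tail_space (v(m := w)) (Suc m))"
proof -
  let ?V = "tail_space v m"
  note V = subspace_tail_space[of v m]
  obtain N where N: "subspace N" "N \<subseteq> ?V" "2 \<le> dim N" "Suc (dim N) = dim ?V" "dominant N ?V"
    and CN: "C = great_sphere N"
    using C unfolding principal_sphere_tail_space psa_children_great_sphere[OF V] by blast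
  define W where "W = ?V \<inter> orthogonal_comp N"
  have "dim W = 1"
    using dim_orthogonal_comp_within[OF N(1) V N(2)] N(4) by (simp add: W_def)
  have sW: "subspace W"
    unfolding W_def using V subspace_orthogonal_comp subspace_inter by blast
  have "W \<noteq> {0}" using \<open>dim W = 1\<close> by (intro notI) simp
  then obtain w where w: "w \<in> W" "norm w = 1" "\<And>x. x \<in> W \<Longrightarrow> quad w * (x \<bullet> x) \<le> quad x"
    using quad_min_exists[OF sW] by metis
  have frame: "greedy_frame (Suc m) (v(m := w))"
    using w dominant_hyperplane_min[OF V N(1,2,5) w[unfolded W_def]]
    by (intro greedy_frame_extend_step[OF v]) (auto simp: W_def)
  have "N \<subseteq> tail_space (v(m := w)) (Suc m)"
    using N(2) w(1) by (auto simp: W_def mem_tail_space mem_orthogonal_comp inner_commute less_Suc_eq)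
  moreover have "dim (tail_space (v(m := w)) (Suc m)) = dim N"
    using dim_tail_space[OF frame] dim_tail_space[OF v] N(4) by simp
  ultimately have "N = tail_space (v(m := w)) (Suc m)"
    using subspace_dim_equal[OF N(1) subspace_tail_space] by simp
  with frame CN N(3) that show thesis by (simp add: principal_sphere_tail_space)
qed

text \<open>
  A path with \<open>k\<close> spheres involves only the first \<open>k - 1\<close> vectors of the frame; the
  others are filled in by \<open>greedy_frame_extend\<close>. When a path is prolonged, the frame chosen
  before is therefore revised from the new vector on, which leaves the spheres on the path unchanged.
\<close>

lemma psa_iff:
  assumes n: "CARD('n) = n + 1" "1 \<le> n"
  shows "p \<in> psa X (sphere 0 1) \<longleftrightarrow>
    (\<exists>v k. greedy_frame CARD('n) v \<and> 1 \<le> k \<and> k \<le> n \<and> p = map (principal_sphere v) [0..<k])"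
proof
  assume "p \<in> psa X (sphere 0 1)"
  then show "\<exists>v k. greedy_frame CARD('n) v \<and> 1 \<le> k \<and> k \<le> n \<and> p = map (principal_sphere v) [0..<k]"
  proof induction
    case root
    obtain v :: "nat \<Rightarrow> real^'n" where "greedy_frame CARD('n) v" using greedy_frame_exists by auto
    moreover have "principal_sphere v 0 = sphere 0 1"
      by (simp add: principal_sphere_def great_sphere_def)
    ultimately show ?case using n(2) by (intro exI[of _ v] exI[of _ 1]) simp
  next
    case (child p C)
    then obtain v k where v: "greedy_frame CARD('n) v" and k: "1 \<le> k" "k \<le> n"
      and p: "p = map (principal_sphere v) [0..<k]" by blast
    obtain m where m: "k = Suc m" using k(1) by (cases k) auto
    have frame: "greedy_frame m v" using v greedy_frame_mono k m n(1) by simp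
    have "C \<in> psa_children X (principal_sphere v m)" using child.hyps(2) p m by simp
    then obtain w where w: "greedy_frame (Suc m) (v(m := w))"
      "C = principal_sphere (v(m := w)) (Suc m)" "2 \<le> dim (tail_space (v(m := w)) (Suc m))"
      using child_of_principal_sphere[OF frame] by metis
    have "Suc k \<le> n" using w(3) dim_tail_space[OF w(1)] n(1) m by simp
    obtain v' where v': "greedy_frame CARD('n) v'" "\<forall>i<Suc m. v' i = (v(m := w)) i"
      using greedy_frame_extend[OF w(1), of "CARD('n)"] k m n(1) by auto
    have "C = principal_sphere v' k"
      unfolding w(2) m principal_sphere_tail_space
      using v'(2) tail_space_cong[of "Suc m" v' "v(m := w)"] by simp
    moreover have "principal_sphere v i = principal_sphere v' i" if "i < k" for i
      unfolding principal_sphere_tail_space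
      using v'(2) that m tail_space_cong[of i v v'] by simp
    ultimately have "p @ [C] = map (principal_sphere v') [0..<Suc k]" by (simp add: p)
    with v'(1) \<open>Suc k \<le> n\<close> show ?case by (metis le_SucI k(1))
  qed
next
  assume "\<exists>v k. greedy_frame CARD('n) v \<and> 1 \<le> k \<and> k \<le> n \<and> p = map (principal_sphere v) [0..<k]"
  then obtain v k where v: "greedy_frame CARD('n) v" and k: "1 \<le> k" "k \<le> n"
    and p: "p = map (principal_sphere v) [0..<k]" by blast
  have "map (principal_sphere v) [0..<k] \<in> psa X (sphere 0 1)"
    using k
  proof (induction k rule: dec_induct)
    case base
    show ?case using psa.root[of "sphere 0 1" X] by (simp add: principal_sphere_def great_sphere_def)
  next
    case (step k)
    obtain m where m: "k = Suc m" using step.hyps(1) by (cases k) auto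
    have frame: "greedy_frame i v" if "i \<le> Suc n" for i
      using greedy_frame_mono[OF v] that n(1) by simp
    have dims: "dim (tail_space v k) = n + 1 - k" "dim (tail_space v m) = n + 1 - m"
      using dim_tail_space[OF frame] step.prems m n(1) by auto
    have "dominant (tail_space v k) (tail_space v m)"
      using step.prems m n(1) by (intro dominant_tail_space[OF v]) auto
    then have "principal_sphere v k \<in> psa_children X (principal_sphere v m)"
      unfolding principal_sphere_tail_space psa_children_great_sphere[OF subspace_tail_space]
      using dims step.prems m tail_space_mono[of m k v] subspace_tail_space
      by (intro imageI) auto
    moreover have "last (map (principal_sphere v) [0..<k]) = principal_sphere v m"
      by (simp add: m)
    ultimately show ?case
      using psa.child[OF step.IH, of "principal_sphere v k"] step.prems by simp
  qed
  then show "p \<in> psa X (sphere 0 1)" using p by simp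
qed

section \<open>Singular systems\<close>

text \<open>
  In coordinates with respect to \<open>v\<close> the form is \<open>\<Sum>j. (s j)\<^sup>2 * (x \<bullet> v j)\<^sup>2\<close>. On the tail space the
  terms with \<open>j < i\<close> vanish, and the other coefficients are at least \<open>(s i)\<^sup>2\<close>.
\<close>

lemma greedy_frame_of_singular_system:
  assumes sv: "singular_system X s v"
  shows "greedy_frame CARD('n) v" and "i < CARD('n) \<Longrightarrow> quad (v i) = (s i)\<^sup>2"
proof -
  let ?d = "CARD('n)"
  have on: "v i \<bullet> v j = (if i = j then 1 else 0)" if "i < ?d" "j < ?d" for i j
    using sv that by (auto simp: singular_system_def)
  have eig: "gram X (v i) = (s i)\<^sup>2 *\<^sub>R v i" "0 \<le> s i" if "i < ?d" for i
    using sv that by (auto simp: singular_system_def gram_def)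
  show q: "quad (v i) = (s i)\<^sup>2" if "i < ?d" for i
    using eig[OF that] on[OF that that] by (simp add: quad_def)
  have inj: "inj_on v {..<?d}" using on by (intro inj_onI) (metis lessThan_iff zero_neq_one)
  have B: "orthonormal (v ` {..<?d})"
    unfolding orthonormal_def pairwise_def orthogonal_def norm_eq_1 using on by auto
  have "dim (v ` {..<?d}) = DIM(real^'n)"
    using orthonormal_card_eq_dim[OF B refl] card_image[OF inj] by simp
  then have sp: "span (v ` {..<?d}) = UNIV" using dim_eq_full by blast
  have ex: "x = (\<Sum>j<?d. (x \<bullet> v j) *\<^sub>R v j)" for x
    using orthonormal_expand[OF B, of x] sp by (simp add: sum.reindex[OF inj])
  interpret f: linear "gram X" by (rule linear)
  have min: "quad (v i) * (x \<bullet> x) \<le> quad x" if i: "i < ?d" and x: "x \<in> tail_space v i" for i x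
  proof -
    have "x \<bullet> x = x \<bullet> (\<Sum>j<?d. (x \<bullet> v j) *\<^sub>R v j)" using ex[of x] by simp
    then have xx: "x \<bullet> x = (\<Sum>j<?d. (x \<bullet> v j)\<^sup>2)"
      unfolding inner_sum_right by (simp add: power2_eq_square)
    have "quad x = x \<bullet> gram X (\<Sum>j<?d. (x \<bullet> v j) *\<^sub>R v j)" using ex[of x] by (simp add: quad_def)
    also have "\<dots> = (\<Sum>j<?d. (s j)\<^sup>2 * (x \<bullet> v j)\<^sup>2)"
      unfolding f.sum f.scale inner_sum_right
      by (rule sum.cong) (auto simp: eig power2_eq_square)
    also have "\<dots> \<ge> (\<Sum>j<?d. (s i)\<^sup>2 * (x \<bullet> v j)\<^sup>2)"
    proof (rule sum_mono)
      fix j assume j: "j \<in> {..<?d}"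
      show "(s i)\<^sup>2 * (x \<bullet> v j)\<^sup>2 \<le> (s j)\<^sup>2 * (x \<bullet> v j)\<^sup>2"
      proof (cases "j < i")
        case True
        then show ?thesis using x by (simp add: mem_tail_space)
      next
        case False
        then have "s i \<le> s j" using sv j by (auto simp: singular_system_def)
        then show ?thesis using eig(2)[OF i] by (intro mult_right_mono power_mono) auto
      qed
    qed
    finally show ?thesis using q[OF i] xx by (simp add: sum_distrib_left)
  qed
  show "greedy_frame ?d v"
    unfolding greedy_frame_def using min on by (auto simp: mem_tail_space norm_eq_1)
qed

lemma singular_system_of_greedy_frame:
  assumes v: "greedy_frame CARD('n) v"
  shows "singular_system X (\<lambda>i. sqrt (quad (v i))) v"
  unfolding singular_system_def
  using greedy_frame_inner[OF v] greedy_frame_eigenvector[OF v] greedy_frame_quad_mono[OF v] quad_nonneg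
  by (auto simp: gram_def)

lemma singular_system_iff_greedy_frame:
  "(\<exists>s. singular_system X s v) \<longleftrightarrow> greedy_frame CARD('n) v"
  using greedy_frame_of_singular_system(1) singular_system_of_greedy_frame by blast

lemma principal_sphere_minimal:
  assumes n: "CARD('n) = n + 1" and v: "greedy_frame CARD('n) v" and m: "m < n"
  shows "is_arg_min (data_dist X) (subsphere (n - m)) (principal_sphere v m)"
proof -
  let ?N = "tail_space v m"
  have dimN: "dim ?N = n - m + 1"
    using dim_tail_space[OF greedy_frame_mono[OF v, of m]] n m by simp
  have "dominant ?N (tail_space v 0)"
    using m n by (intro dominant_tail_space[OF v]) auto
  then have dom: "dominant ?N UNIV" by (simp add: tail_space_def)
  have "data_dist X (great_sphere ?N) \<le> data_dist X (great_sphere D)"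
    if D: "subspace D" "dim D = n - m + 1" for D
  proof -
    have "?N \<noteq> {0}" "D \<noteq> {0}" using dimN D(2) by (simp_all add: nonzero_of_dim_pos)
    then show ?thesis
      using dominant_trace_max[OF subspace_UNIV subspace_tail_space subset_UNIV D(1) subset_UNIV _ dom]
        data_dist_le_iff[OF subspace_tail_space _ D(1)] dimN D(2) by simp
  qed
  then show ?thesis
    unfolding is_arg_min_linorder principal_sphere_tail_space subsphere_def
    using subspace_tail_space dimN by blast
qed

lemma principal_sphere_unique:
  assumes n: "CARD('n) = n + 1" and v: "greedy_frame CARD('n) v" and m: "Suc m < n"
    and gap: "quad (v m) < quad (v (Suc m))"
    and S: "is_arg_min (data_dist X) (subsphere (n - Suc m)) S"
  shows "S = principal_sphere v (Suc m)"
proof -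
  let ?N = "tail_space v (Suc m)"
  have dimN: "dim ?N = n - m"
    using dim_tail_space[OF greedy_frame_mono[OF v, of "Suc m"]] n m by simp
  obtain D where D: "subspace D" "dim D = n - m" "S = great_sphere D"
    using S m by (auto simp: is_arg_min_linorder subsphere_def Suc_diff_Suc)
  have nz: "?N \<noteq> {0}" "D \<noteq> {0}" using dimN D(2) m by (simp_all add: nonzero_of_dim_pos)
  have "data_dist X S \<le> data_dist X (principal_sphere v (Suc m))"
    using S principal_sphere_minimal[OF n v m] by (simp add: is_arg_min_linorder)
  then have "trace_on (gram X) ?N \<le> trace_on (gram X) D"
    using data_dist_le_iff[OF D(1) nz(2) subspace_tail_space nz(1)] D(3)
    by (simp add: principal_sphere_tail_space)
  then have "D = ?N"
    using m n gap D(1,2) dimN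
    by (intro trace_maximiser_unique[OF v, of 0]) (auto simp: tail_space_def)
  then show ?thesis by (simp add: D(3) principal_sphere_tail_space)
qed

text \<open>
  A dominant subspace attains the largest trace for its dimension, as the tail space of that
  dimension does, and with gaps only the latter can.
\<close>

lemma symm_space_approx_principal_sphere:
  assumes n: "CARD('n) = n + 1" and v: "greedy_frame CARD('n) v" and i: "i < n"
    and gaps: "\<And>m. Suc m < n \<Longrightarrow> quad (v m) < quad (v (Suc m))"
  shows "symm_space_approx X (principal_sphere v i) = principal_sphere v ` {i..<n}"
proof -
  let ?V = "tail_space v i"
  have dims: "dim (tail_space v j) = n + 1 - j" if "j \<le> n" for j
    using dim_tail_space[OF greedy_frame_mono[OF v, of j]] n that by simp
  have dom: "dominant (tail_space v j) ?V" if "i \<le> j" "j < n" for j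
    using n that by (intro dominant_tail_space[OF v]) auto
  have "N \<in> tail_space v ` {i..<n}"
    if N: "subspace N" "N \<subseteq> ?V" "2 \<le> dim N" "dominant N ?V" for N
  proof -
    define j where "j = n + 1 - dim N"
    have "dim N \<le> n + 1 - i" using dim_subset[OF N(2)] dims[of i] i by simp
    then have j: "i \<le> j" "j < n" using N(3) i by (auto simp: j_def)
    have dN: "dim N = dim (tail_space v j)"
      using dims[of j] j \<open>dim N \<le> n + 1 - i\<close> N(3) by (simp add: j_def)
    have "N = tail_space v j"
    proof (cases "i = j")
      case True
      then show ?thesis using subspace_dim_equal[OF N(1) subspace_tail_space N(2)] dN by simp
    next
      case False
      then obtain m where m: "j = Suc m" "i \<le> m" using j(1) by (cases j) auto
      have "trace_on (gram X) (tail_space v j) \<le> trace_on (gram X) N"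
        using tail_space_mono[OF j(1)] dN
        by (intro dominant_trace_max[OF subspace_tail_space N(1,2) subspace_tail_space _ _ N(4)]) auto
      then show ?thesis
        unfolding m using m j n gaps N dN
        by (intro trace_maximiser_unique[OF v m(2)]) auto
    qed
    then show ?thesis using j by auto
  qed
  moreover have "subspace (tail_space v j) \<and> tail_space v j \<subseteq> ?V \<and> 2 \<le> dim (tail_space v j)
      \<and> dominant (tail_space v j) ?V" if "j \<in> {i..<n}" for j
    using that dom dims[of j] tail_space_mono[of i j v] subspace_tail_space by auto
  ultimately have "{N. subspace N \<and> N \<subseteq> ?V \<and> 2 \<le> dim N \<and> dominant N ?V} = tail_space v ` {i..<n}"
    by blast
  then show ?thesis
    unfolding principal_sphere_tail_space symm_space_approx_great_sphere[OF subspace_tail_space]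
    by (simp add: image_image)
qed

lemma psa_eq_Union:
  assumes n: "CARD('n) = n + 1" "1 \<le> n"
  shows "psa X (sphere 0 1) =
    (\<Union>v\<in>{v. greedy_frame CARD('n) v}. unbranched_tree (map (principal_sphere v) [0..<n]))"
proof -
  have prefix_iff: "p \<in> unbranched_tree (map g [0..<n]) \<longleftrightarrow> (\<exists>k. 1 \<le> k \<and> k \<le> n \<and> p = map g [0..<k])"
    for p and g :: "nat \<Rightarrow> (real^'n) set"
  proof
    assume "p \<in> unbranched_tree (map g [0..<n])"
    then have p: "p \<noteq> []" "prefix p (map g [0..<n])" by (auto simp: unbranched_tree_def)
    then have "p = take (length p) (map g [0..<n])" by (metis prefix_def append_eq_conv_conj)
    moreover have "length p \<le> n" using prefix_length_le[OF p(2)] by simp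
    ultimately have "p = map g [0..<length p]" by (simp add: take_map)
    with p(1) \<open>length p \<le> n\<close> show "\<exists>k. 1 \<le> k \<and> k \<le> n \<and> p = map g [0..<k]"
      by (intro exI[of _ "length p"]) (simp add: Suc_le_eq)
  next
    assume "\<exists>k. 1 \<le> k \<and> k \<le> n \<and> p = map g [0..<k]"
    then obtain k where k: "1 \<le> k" "k \<le> n" "p = map g [0..<k]" by blast
    then have "p = take k (map g [0..<n])" by (simp add: take_map)
    then show "p \<in> unbranched_tree (map g [0..<n])"
      using k take_is_prefix[of k "map g [0..<n]"] by (auto simp: unbranched_tree_def)
  qed
  show ?thesis
    by (rule set_eqI) (unfold UN_iff mem_Collect_eq psa_iff[OF n] prefix_iff, blast)
qed

end

theorem corollary1:
  fixes X :: "real^'d^'n" and n :: nat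
  assumes "CARD('n) = n + 1" and "1 \<le> n"
    and "\<And>j. column j X \<in> sphere 0 1"
  shows
    "psa X (sphere 0 1) =
       (\<Union>v\<in>{v. \<exists>s. singular_system X s v}. unbranched_tree (map (principal_sphere v) [0..<n]))
     \<and> (\<forall>s v. singular_system X s v \<longrightarrow>
          principal_sphere v 0 = sphere 0 1
        \<and> (\<forall>m. 0 < m \<and> m < n \<longrightarrow>
              is_arg_min (data_dist X) (subsphere (n - m)) (principal_sphere v m)
            \<and> (s (m - 1) < s m \<longrightarrow>
                 (\<forall>S. is_arg_min (data_dist X) (subsphere (n - m)) S \<longrightarrow> S = principal_sphere v m)))
        \<and> ((\<forall>m. 0 < m \<and> m < n \<longrightarrow> s (m - 1) < s m) \<longrightarrow>
              psa X (sphere 0 1) = unbranched_tree (map (principal_sphere v) [0..<n])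
            \<and> (\<forall>i<n. symm_space_approx X (principal_sphere v i) = principal_sphere v ` {i..<n})))"
proof -
  interpret data_matrix X .
  note n = assms(1,2)
  have psa: "psa X (sphere 0 1) =
      (\<Union>v\<in>{v. \<exists>s. singular_system X s v}. unbranched_tree (map (principal_sphere v) [0..<n]))"
    unfolding singular_system_iff_greedy_frame by (rule psa_eq_Union[OF n])
  have S0: "principal_sphere v 0 = sphere 0 1" for v :: "nat \<Rightarrow> real^'n"
    by (simp add: principal_sphere_def great_sphere_def)
  have minimal: "is_arg_min (data_dist X) (subsphere (n - m)) (principal_sphere v m)"
    if "singular_system X s v" "m < n" for s v m
    using principal_sphere_minimal[OF n(1) greedy_frame_of_singular_system(1)] that by blast
  have gap: "quad (v m) < quad (v (Suc m))"
    if sv: "singular_system X s v" and m: "Suc m < n" and lt: "s m < s (Suc m)" for s v m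
  proof -
    have "0 \<le> s m" using sv m n(1) by (auto simp: singular_system_def)
    then have "(s m)\<^sup>2 < (s (Suc m))\<^sup>2" using lt by (simp add: power_strict_mono)
    then show ?thesis using greedy_frame_of_singular_system(2)[OF sv] m n(1) by simp
  qed
  have unique: "S = principal_sphere v m"
    if sv: "singular_system X s v" and m: "0 < m" "m < n" and lt: "s (m - 1) < s m"
      and S: "is_arg_min (data_dist X) (subsphere (n - m)) S" for s v m S
  proof -
    obtain l where l: "m = Suc l" using m(1) by (cases m) auto
    show ?thesis
      using principal_sphere_unique[OF n(1) greedy_frame_of_singular_system(1)[OF sv]]
        gap[OF sv] m(2) lt S unfolding l by simp
  qed
  have tree: "psa X (sphere 0 1) = unbranched_tree (map (principal_sphere v) [0..<n])"
    if sv: "singular_system X s v" and gaps: "\<forall>m. 0 < m \<and> m < n \<longrightarrow> s (m - 1) < s m" for s v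
  proof -
    have "principal_sphere v' m = principal_sphere v m" if "singular_system X s' v'" "m < n" for s' v' m
      using unique[OF sv] minimal[OF that] gaps that(2) S0 by (cases "m = 0") auto
    then have "psa X (sphere 0 1) = (\<Union>v'\<in>{v'. \<exists>s'. singular_system X s' v'}.
        unbranched_tree (map (principal_sphere v) [0..<n]))"
      unfolding psa by (intro SUP_cong refl arg_cong[where f = unbranched_tree] map_cong) auto
    then show ?thesis using sv by auto
  qed
  have approx: "symm_space_approx X (principal_sphere v i) = principal_sphere v ` {i..<n}"
    if sv: "singular_system X s v" and gaps: "\<forall>m. 0 < m \<and> m < n \<longrightarrow> s (m - 1) < s m" and i: "i < n"
    for s v i
  proof (rule symm_space_approx_principal_sphere[OF n(1) greedy_frame_of_singular_system(1)[OF sv] i])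
    show "quad (v m) < quad (v (Suc m))" if "Suc m < n" for m
      using gap[OF sv that] gaps[rule_format, of "Suc m"] that by simp
  qed
  show ?thesis
  proof (intro conjI allI impI)
    show "psa X (sphere 0 1) =
        (\<Union>v\<in>{v. \<exists>s. singular_system X s v}. unbranched_tree (map (principal_sphere v) [0..<n]))"
      by (rule psa)
  next
    fix s v assume sv: "singular_system X s v"
    show "principal_sphere v 0 = sphere 0 1" by (rule S0)
    {
      fix m assume m: "0 < m \<and> m < n"
      show "is_arg_min (data_dist X) (subsphere (n - m)) (principal_sphere v m)"
        by (rule minimal[OF sv conjunct2[OF m]])
      fix S assume "s (m - 1) < s m" and "is_arg_min (data_dist X) (subsphere (n - m)) S"
      then show "S = principal_sphere v m"
        by (rule unique[OF sv conjunct1[OF m] conjunct2[OF m]])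
    }
    assume gaps: "\<forall>m. 0 < m \<and> m < n \<longrightarrow> s (m - 1) < s m"
    show "psa X (sphere 0 1) = unbranched_tree (map (principal_sphere v) [0..<n])"
      by (rule tree[OF sv gaps])
    fix i assume "i < n"
    then show "symm_space_approx X (principal_sphere v i) = principal_sphere v ` {i..<n}"
      by (rule approx[OF sv gaps])
  qed
qed

end
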